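(* Let $N\ge 1$ and $T>0$. Consider the system $\mathbf{M}\ddot{\mathbf{q}}+\mathbf{C}\dot{\mathbf{q}}+\mathbf{S}(\mathbf{q})=\mathbf{f}(t)$, $\mathbf{q}\in\mathbb{R}^N$, where $\mathbf{M}\in\mathbb{R}^{N\times N}$ is symmetric positive definite, $\mathbf{C}\in\mathbb{R}^{N\times N}$, $\mathbf{S}:\mathbb{R}^N\to\mathbb{R}^N$ is continuous, and $\mathbf{f}:\mathbb{R}\to\mathbb{R}^N$ is continuous and $T$-periodic, with mean $\bar{\mathbf{f}}=\frac1T\int_0^T\mathbf{f}(t)\,dt$. Assume: (1) There exists a constant $C_0>0$ such that $|\mathbf{x}^T\mathbf{C}\mathbf{x}|>C_0|\mathbf{x}|^2$ for all $\mathbf{x}\in\mathbb{R}^N\setminus\{\mathbf{0}\}$. (2) There exists a continuously differentiable function $V:\mathbb{R}^N\to\mathbb{R}$ such that $\mathbf{S}(\mathbf{q})=\frac{\partial V(\mathbf{q})}{\partial\mathbf{q}}$ for all $\mathbf{q}\in\mathbb{R}^N$. (3) There exist $r>0$ and an integer $0\le n\le N$ such that for all $\mathbf{q}\in\mathbb{R}^N$: $q_j\,(S_j(\mathbf{q})-\bar f_j)>0$ whenever $|q_j|>r$, for $j=1,\dots,n$; and $q_j\,(S_j(\mathbf{q})-\bar f_j)<0$ whenever $|q_j|>r$, for $j=n+1,\dots,N$. Then the system has a twice continuously differentiable $T$-periodic solution $\mathbf{q}:\mathbb{R}\to\mathbb{R}^N$.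
   Context: $|\cdot|$ is the Euclidean norm on $\mathbb{R}^N$; $q_j,S_j,\bar f_j$ denote the $j$-th components of $\mathbf{q},\mathbf{S},\bar{\mathbf{f}}$. In (3), the inequality for index $j$ is required for all $\mathbf{q}$ with $|q_j|>r$, whatever the values of the other components. *)

theory Defs
  imports "HOL-Analysis.Analysis"
begin

definition sym_pos_def :: "real ^ 'n ^ 'n \<Rightarrow> bool" where
  "sym_pos_def M \<longleftrightarrow> transpose M = M \<and> (\<forall>x. x \<noteq> 0 \<longrightarrow> x \<bullet> (M *v x) > 0)"

text \<open>Continuous differentiability of the potential \<open>V\<close> is the continuity of its gradient,
  which is required to be \<open>S\<close>.\<close>
definition C1_potential :: "(real ^ 'n \<Rightarrow> real) \<Rightarrow> (real ^ 'n \<Rightarrow> real ^ 'n) \<Rightarrow> bool" where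
  "C1_potential V S \<longleftrightarrow> (\<forall>q. GDERIV V q :> S q) \<and> continuous_on UNIV S"

definition period_mean :: "real \<Rightarrow> (real \<Rightarrow> real ^ 'n) \<Rightarrow> real ^ 'n" where
  "period_mean T f = (1 / T) *\<^sub>R integral {0..T} f"

definition C2_solution ::
  "real ^ 'n ^ 'n \<Rightarrow> real ^ 'n ^ 'n \<Rightarrow> (real ^ 'n \<Rightarrow> real ^ 'n) \<Rightarrow> (real \<Rightarrow> real ^ 'n)
    \<Rightarrow> (real \<Rightarrow> real ^ 'n) \<Rightarrow> bool" where
  "C2_solution M C S f q \<longleftrightarrow>
    (\<exists>q' q''. (\<forall>t. (q has_vector_derivative q' t) (at t)) \<and>
             (\<forall>t. (q' has_vector_derivative q'' t) (at t)) \<and>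
             continuous_on UNIV q'' \<and>
             (\<forall>t. M *v q'' t + C *v q' t + S (q t) = f t))"

end

theory Submission
  imports Defs "HOL-Complex_Analysis.Great_Picard"
begin

text \<open>Integrating the equation twice turns a \<open>T\<close>-periodic solution into a fixed point of a compact
  operator \<open>G\<close> on continuous functions on \<open>[0, T]\<close>, to which the Leray--Schauder alternative
  applies. For a solution of \<open>q = lam G q\<close> with \<open>0 < lam \<le> 1\<close>, testing with the velocity kills
  the inertial and the gradient terms over a period, so the definite damping bounds the
  oscillation of \<open>q\<close>; and the mean of the \<open>j\<close>-th equation vanishes, so by the sign condition
  \<open>\<bar>q\<^sub>j\<bar> \<le> r\<close> at some time. Together these bound \<open>q\<close> independently of \<open>lam\<close>.

  The fixed point theorem is obtained from Kuhn's combinatorial lemma: Brouwer's theorem is needed in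
  every finite dimension at once, whereas the library version has the dimension in the type.
  Bernstein polynomials reduce Schauder's theorem to it.\<close>

subsection \<open>Fixed points of Lipschitz-valued operators\<close>

text \<open>The periodic problem for \<open>M q''\<close> is resonant: constants lie in its kernel,
  and only right-hand sides of mean zero are admissible. The operator therefore has two blocks: a
  mean-zero one, in which \<open>M q''\<close> is inverted, and a finite-dimensional one, which
  keeps the mean of \<open>q\<close> and subtracts the obstruction \<open>mean (S q - f)\<close>. In
  the second block each coordinate of the obstruction is multiplied by a sign \<open>eps j\<close>,
  so that both terms of \<open>(1 - lam) q_j + lam eps_j (S_j - mean f_j)\<close> have the sign of
  \<open>q_j\<close> once \<open>\<bar>q_j\<bar> > r\<close>. Coordinates with either sign condition
  are then treated alike, and no degree has to be computed. The damping is placed in the part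
  multiplied by \<open>lam\<close>, so it weakens along the homotopy; but the forcing weakens at the
  same rate. Dividing the energy balance by \<open>lam\<close> leaves an oscillation bound that
  depends only on \<open>T\<close>, \<open>C0\<close> and the maximum of
  \<open>\<bar>f\<bar>\<close>.\<close>

lemma finite_bounded_coordinates_subseq:
  fixes x :: "nat \<Rightarrow> 'i \<Rightarrow> real"
  assumes "finite I" and bnd: "\<And>n i. i \<in> I \<Longrightarrow> x n i \<in> {a..b}"
  shows "\<exists>l r. strict_mono (r :: nat \<Rightarrow> nat) \<and> (\<forall>i\<in>I. (\<lambda>n. x (r n) i) \<longlonglongrightarrow> l i)"
proof -
  have b: "bounded ((\<lambda>y. y i) ` range x)" if "i \<in> I" for i
    by (rule bounded_subset[of "{a..b}"]) (use that bnd in auto)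
  obtain l r where r: "strict_mono (r :: nat \<Rightarrow> nat)"
    and l: "\<forall>e>0. eventually (\<lambda>n. \<forall>i\<in>I. dist (x (r n) i) (l i) < e) sequentially"
    using compact_lemma_general[of I "\<lambda>y i. y i" x "\<lambda>y. y"] assms(1) b by auto
  show ?thesis
  proof (intro exI conjI ballI, rule r)
    fix i assume "i \<in> I"
    then show "(\<lambda>n. x (r n) i) \<longlonglongrightarrow> l i"
      unfolding tendsto_iff using l by (auto elim!: eventually_mono)
  qed
qed

text \<open>Each grid point is labelled in coordinate \<open>i\<close> by the sign of
  \<open>F x i - x i\<close>. Kuhn's lemma yields a grid cell that carries both labels in every
  coordinate; as the mesh shrinks, a limit of such cells is a fixed point. Points are functions on a
  finite set \<open>I\<close>, so the dimension may vary. Constant sequences in \<open>cont\<close>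
  show that on the cube the components of \<open>F\<close> in \<open>I\<close> see only the
  coordinates in \<open>I\<close>.\<close>

lemma brouwer_finite_cube:
  fixes F :: "('i \<Rightarrow> real) \<Rightarrow> 'i \<Rightarrow> real"
  assumes fin: "finite I" and ab: "a < b"
    and maps: "\<And>x i. (\<forall>j\<in>I. x j \<in> {a..b}) \<Longrightarrow> i \<in> I \<Longrightarrow> F x i \<in> {a..b}"
    and cont: "\<And>u x i. (\<And>n. \<forall>j\<in>I. u n j \<in> {a..b}) \<Longrightarrow>
        (\<And>j. j \<in> I \<Longrightarrow> (\<lambda>n. u n j) \<longlonglongrightarrow> x j) \<Longrightarrow> i \<in> I \<Longrightarrow> (\<lambda>n. F (u n) i) \<longlonglongrightarrow> F x i"
  obtains x where "\<And>i. i \<in> I \<Longrightarrow> x i \<in> {a..b}" "\<And>i. i \<in> I \<Longrightarrow> F x i = x i"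
proof -
  obtain n e where e: "bij_betw e {..<n::nat} I"
    using ex_bij_betw_nat_finite[OF fin] by (auto simp: atLeast0LessThan)
  define e' where "e' = inv_into {..<n} e"
  have e'I: "e' i < n" and ee': "e (e' i) = i" if "i \<in> I" for i
    using e that unfolding e'_def
    by (metis bij_betw_def inv_into_into lessThan_iff, metis bij_betw_inv_into_right)
  have eI: "e k \<in> I" and e'e: "e' (e k) = k" if "k < n" for k
    using e that unfolding e'_def
    by (metis bij_betwE lessThan_iff, simp add: bij_betw_inv_into_left)
  define v where "v p y i = a + (b - a) * (real (y (e' i)) / real p)" for p :: nat and y :: "nat \<Rightarrow> nat" and i
  have v_cube: "v p y i \<in> {a..b}" if "0 < p" "\<forall>k<n. y k \<le> p" "i \<in> I" for p y i
  proof -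
    have "real (y (e' i)) / real p \<in> {0..1}"
      using that e'I[OF that(3)] by (auto simp: divide_simps)
    then show ?thesis
      using ab mult_left_le[of "real (y (e' i)) / real p" "b - a"] unfolding v_def by auto
  qed
  \<comment> \<open>Kuhn's lemma prescribes the labels on the faces. They remain compatible with the
    inequalities because \<open>F\<close> maps the cube into itself; this is the boundary case of
    \<open>lab0\<close> and \<open>lab1\<close>.\<close>
  define lab where "lab p y k = (if y k = 0 then 0 else if y k = p then 1
      else if F (v p y) (e k) \<ge> v p y (e k) then 0 else (1::nat))" for p :: nat and y :: "nat \<Rightarrow> nat" and k
  \<comment> \<open>The vertices \<open>lo\<close> and \<open>hi\<close> depend on \<open>i\<close>,
    the base point \<open>z\<close> of the cell does not. A subsequence is extracted for
    \<open>z\<close> alone, and the vertices follow it because the mesh tends to 0.\<close>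
  define around where "around p z i lo hi \<longleftrightarrow>
      (\<forall>j\<in>I. lo j \<in> {a..b} \<and> hi j \<in> {a..b} \<and>
        \<bar>lo j - z j\<bar> \<le> (b - a) / real p \<and> \<bar>hi j - z j\<bar> \<le> (b - a) / real p) \<and>
      F lo i \<ge> lo i \<and> F hi i \<le> hi i" for p :: nat and z :: "'i \<Rightarrow> real" and i lo hi
  have ex: "\<exists>z. (\<forall>i\<in>I. z i \<in> {a..b}) \<and> (\<forall>i\<in>I. \<exists>lo hi. around p z i lo hi)" if p: "0 < p" for p
  proof -
    obtain q where q: "\<forall>i<n. q i < p"
      "\<forall>i<n. \<exists>r s. (\<forall>j<n. q j \<le> r j \<and> r j \<le> q j + 1) \<and> (\<forall>j<n. q j \<le> s j \<and> s j \<le> q j + 1) \<and> lab p r i \<noteq> lab p s i"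
      by (rule kuhn_lemma[OF p, of n "lab p"]) (use p in \<open>auto simp: lab_def\<close>)
    have near: "\<bar>v p r j - v p q j\<bar> \<le> (b - a) / real p" if "\<forall>j<n. q j \<le> r j \<and> r j \<le> q j + 1" "j \<in> I" for r j
    proof -
      have *: "\<bar>real (r (e' j)) - real (q (e' j))\<bar> \<le> 1"
        using that e'I[OF that(2)] by (auto simp: abs_le_iff)
      moreover have "v p r j - v p q j = (b - a) * (real (r (e' j)) - real (q (e' j))) / real p"
        unfolding v_def by (simp add: right_diff_distrib diff_divide_distrib)
      ultimately have "\<bar>v p r j - v p q j\<bar> = (b - a) * \<bar>real (r (e' j)) - real (q (e' j))\<bar> / real p"
        using ab by (simp add: abs_mult)
      also have "\<dots> \<le> (b - a) * 1 / real p"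
        using ab * by (intro divide_right_mono mult_left_mono) auto
      finally show ?thesis by simp
    qed
    have bd: "\<forall>j<n. r j \<le> p" if "\<forall>j<n. q j \<le> r j \<and> r j \<le> q j + 1" for r
      using that q(1) by (metis Suc_eq_plus1 Suc_leI le_trans)
    have lab0: "F (v p r) (e k) \<ge> v p r (e k)" if "\<forall>j<n. r j \<le> p" "k < n" "lab p r k = 0" for r k
    proof (cases "r k = 0")
      case True
      then have "v p r (e k) = a" using that by (simp add: v_def e'e)
      then show ?thesis using maps[of "v p r" "e k"] v_cube[OF p] that eI by auto
    next
      case False
      then show ?thesis using that unfolding lab_def by (auto split: if_splits)
    qed
    have lab1: "F (v p r) (e k) \<le> v p r (e k)" if "\<forall>j<n. r j \<le> p" "k < n" "lab p r k \<noteq> 0" for r k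
    proof (cases "r k = p")
      case True
      then have "v p r (e k) = b" using that p by (simp add: v_def e'e)
      then show ?thesis using maps[of "v p r" "e k"] v_cube[OF p] that eI by auto
    next
      case False
      then show ?thesis using that unfolding lab_def by (auto split: if_splits)
    qed
    have "\<exists>lo hi. around p (v p q) i lo hi" if i: "i \<in> I" for i
    proof -
      obtain r s where rs: "\<forall>j<n. q j \<le> r j \<and> r j \<le> q j + 1" "\<forall>j<n. q j \<le> s j \<and> s j \<le> q j + 1"
          "lab p r (e' i) \<noteq> lab p s (e' i)"
        using q(2) e'I[OF i] by blast
      obtain r s where rs: "\<forall>j<n. q j \<le> r j \<and> r j \<le> q j + 1" "\<forall>j<n. q j \<le> s j \<and> s j \<le> q j + 1"
          "lab p r (e' i) = 0" "lab p s (e' i) \<noteq> 0"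
      proof (cases "lab p r (e' i) = 0")
        case True
        then show ?thesis using that[of r s] rs by auto
      next
        case False
        then have "lab p s (e' i) = 0" using rs(3) unfolding lab_def by (auto split: if_splits)
        then show ?thesis using that[of s r] rs False by auto
      qed
      show ?thesis
        unfolding around_def
      proof (rule exI[of _ "v p r"], rule exI[of _ "v p s"], intro conjI ballI)
        show "v p r i \<le> F (v p r) i"
          using lab0[OF bd[OF rs(1)] e'I[OF i] rs(3)] ee'[OF i] by simp
        show "F (v p s) i \<le> v p s i"
          using lab1[OF bd[OF rs(2)] e'I[OF i] rs(4)] ee'[OF i] by simp
        fix j assume j: "j \<in> I"
        show "v p r j \<in> {a..b}" "v p s j \<in> {a..b}"
          using v_cube[OF p bd j] rs by blast+
        show "\<bar>v p r j - v p q j\<bar> \<le> (b - a) / real p" "\<bar>v p s j - v p q j\<bar> \<le> (b - a) / real p"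
          using near j rs by blast+
      qed
    qed
    moreover have "\<forall>i\<in>I. v p q i \<in> {a..b}"
      using v_cube[OF p _, of q] q(1) by (simp add: less_imp_le)
    ultimately show ?thesis by blast
  qed
  obtain z where z: "\<And>m i. i \<in> I \<Longrightarrow> z m i \<in> {a..b}"
    and "\<And>m i. i \<in> I \<Longrightarrow> \<exists>lo hi. around (Suc m) (z m) i lo hi"
    using ex[OF zero_less_Suc] by metis
  then have "\<forall>m i. \<exists>lo hi. i \<in> I \<longrightarrow> around (Suc m) (z m) i lo hi"
    by blast
  then obtain lo hi where lohi': "\<And>m i. i \<in> I \<Longrightarrow> around (Suc m) (z m) i (lo m i) (hi m i)"
    unfolding choice_iff by blast
  have cube: "lo m i j \<in> {a..b}" "hi m i j \<in> {a..b}"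
    and near: "\<bar>lo m i j - z m j\<bar> \<le> (b - a) / real (Suc m)" "\<bar>hi m i j - z m j\<bar> \<le> (b - a) / real (Suc m)"
    if "i \<in> I" "j \<in> I" for m i j
    using lohi'[OF that(1), of m] that(2) by (simp_all add: around_def)
  have lohi: "F (lo m i) i \<ge> lo m i i" "F (hi m i) i \<le> hi m i i" if "i \<in> I" for m i
    using lohi'[OF that, of m] by (simp_all add: around_def)
  obtain x r where r: "strict_mono (r :: nat \<Rightarrow> nat)" and x: "\<And>i. i \<in> I \<Longrightarrow> (\<lambda>m. z (r m) i) \<longlonglongrightarrow> x i"
    using finite_bounded_coordinates_subseq[of I z a b, OF fin z] by blast
  have small: "(\<lambda>m. (b - a) / real (Suc (r m))) \<longlonglongrightarrow> 0"
    using LIMSEQ_subseq_LIMSEQ[OF LIMSEQ_Suc[OF lim_const_over_n[of "b - a"]] r] by (simp add: o_def)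
  have lim: "(\<lambda>m. w (r m) j) \<longlonglongrightarrow> x j"
    if "\<And>m. \<bar>w m j - z m j\<bar> \<le> (b - a) / real (Suc m)" "j \<in> I" for w j
  proof -
    have "(\<lambda>m. w (r m) j - z (r m) j) \<longlonglongrightarrow> 0"
      by (rule Lim_null_comparison[OF _ small]) (use that in auto)
    from tendsto_add[OF this x[OF that(2)]] show ?thesis by simp
  qed
  show ?thesis
  proof (rule that[of x])
    fix i assume i: "i \<in> I"
    show "x i \<in> {a..b}"
      by (rule closed_sequentially[OF closed_real_atLeastAtMost _ x[OF i]]) (use z i in auto)
    have lo: "(\<lambda>m. lo (r m) i j) \<longlonglongrightarrow> x j" and hi: "(\<lambda>m. hi (r m) i j) \<longlonglongrightarrow> x j" if "j \<in> I" for j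
      using lim[of "\<lambda>m. lo m i", OF near(1)[OF i that] that] lim[of "\<lambda>m. hi m i", OF near(2)[OF i that] that]
      by simp_all
    have "(\<lambda>m. F (lo (r m) i) i) \<longlonglongrightarrow> F x i"
      by (rule cont[OF _ lo i]) (use cube(1)[OF i] in simp_all)
    from LIMSEQ_le[OF lo[OF i] this] have "x i \<le> F x i"
      using lohi(1)[OF i] by blast
    moreover have "(\<lambda>m. F (hi (r m) i) i) \<longlonglongrightarrow> F x i"
      by (rule cont[OF _ hi i]) (use cube(2)[OF i] in simp_all)
    from LIMSEQ_le[OF this hi[OF i]] have "F x i \<le> x i"
      using lohi(2)[OF i] by blast
    ultimately show "F x i = x i" by simp
  qed
qed

section \<open>Bernstein approximation of curves on a compact interval\<close>

text \<open>Elements are total functions, arbitrary outside \<open>{0..T}\<close>; the topology is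
  expressed by \<open>uniform_limit {0..T}\<close> and not by a function-space type.\<close>

definition cont_ball :: "real \<Rightarrow> real \<Rightarrow> (real \<Rightarrow> 'b::real_normed_vector) set" where
  "cont_ball T K = {q. continuous_on {0..T} q \<and> (\<forall>t\<in>{0..T}. norm (q t) \<le> K)}"

text \<open>The Bezier curve with control points \<open>c k\<close>, rescaled to
  \<open>{0..T}\<close>; in general it does not pass through the inner control points.\<close>

definition bernstein_interp :: "real \<Rightarrow> nat \<Rightarrow> (nat \<Rightarrow> 'b::real_normed_vector) \<Rightarrow> real \<Rightarrow> 'b" where
  "bernstein_interp T m c t = (\<Sum>k\<le>m. Bernstein m k (t / T) *\<^sub>R c k)"

lemma continuous_on_bernstein_interp:
  "T \<noteq> 0 \<Longrightarrow> continuous_on A (bernstein_interp T m c)"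
  unfolding bernstein_interp_def Bernstein_def by (intro continuous_intros) auto

lemma bernstein_interp_diff:
  "bernstein_interp T m c t - bernstein_interp T m d t = bernstein_interp T m (\<lambda>k. c k - d k) t"
  by (simp add: bernstein_interp_def sum_subtractf scaleR_diff_right)

text \<open>On \<open>{0..T}\<close> the Bernstein weights are nonnegative and sum to 1. With
  \<open>bernstein_interp_diff\<close> this makes the curve a nonexpansive function of its control
  points in the sup norm.\<close>

lemma norm_bernstein_interp_le:
  assumes "0 < T" "t \<in> {0..T}" "\<And>k. k \<le> m \<Longrightarrow> norm (c k) \<le> K"
  shows "norm (bernstein_interp T m c t) \<le> K"
proof -
  have nn: "0 \<le> Bernstein m k (t / T)" for k
    using assms by (intro Bernstein_nonneg) (auto simp: divide_simps)
  have "norm (bernstein_interp T m c t) \<le> (\<Sum>k\<le>m. Bernstein m k (t / T) * K)"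
    unfolding bernstein_interp_def
    by (rule sum_norm_le) (use assms nn in \<open>auto intro!: mult_left_mono\<close>)
  also have "\<dots> = K"
    by (simp flip: sum_distrib_right)
  finally show ?thesis .
qed

lemma uniform_limit_bernstein_interp:
  fixes y :: "real \<Rightarrow> 'b::euclidean_space"
  assumes T: "0 < T" and y: "continuous_on {0..T} y"
  shows "uniform_limit {0..T} (\<lambda>m. bernstein_interp T m (\<lambda>k. y (T * (real k / real m)))) y sequentially"
proof (rule uniform_limitI)
  fix e :: real assume e: "0 < e"
  \<comment> \<open>Weierstrass approximation is applied in each coordinate; the l1 bound on the
    norm adds up \<open>DIM('b)\<close> errors, and the factor 2 keeps the sum strictly below
    \<open>e\<close>.\<close>
  define d where "d = e / (2 * real DIM('b))"
  have d: "0 < d" using e by (simp add: d_def)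
  have "\<forall>\<^sub>F m in sequentially. \<forall>x\<in>{0..1}.
      \<bar>y (T * x) \<bullet> b - (\<Sum>k\<le>m. (y (T * (k / m)) \<bullet> b) * Bernstein m k x)\<bar> < d" if "b \<in> Basis" for b
  proof -
    have "continuous_on {0..1} (\<lambda>x. y (T * x) \<bullet> b)"
      using T by (intro continuous_intros continuous_on_compose2[OF y]) (auto simp: mult_left_le)
    from Bernstein_Weierstrass[OF this d] show ?thesis
      unfolding eventually_sequentially by blast
  qed
  then have "\<forall>\<^sub>F m in sequentially. \<forall>b\<in>Basis. \<forall>x\<in>{0..1}.
      \<bar>y (T * x) \<bullet> b - (\<Sum>k\<le>m. (y (T * (k / m)) \<bullet> b) * Bernstein m k x)\<bar> < d"
    by (intro eventually_ball_finite) auto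
  then show "\<forall>\<^sub>F m in sequentially. \<forall>t\<in>{0..T}. dist (bernstein_interp T m (\<lambda>k. y (T * (real k / real m))) t) (y t) < e"
  proof (rule eventually_mono, intro ballI)
    fix m t
    assume *: "\<forall>b\<in>Basis. \<forall>x\<in>{0..1}.
      \<bar>y (T * x) \<bullet> b - (\<Sum>k\<le>m. (y (T * (k / m)) \<bullet> b) * Bernstein m k x)\<bar> < d" and t: "t \<in> {0..T}"
    let ?v = "y t - bernstein_interp T m (\<lambda>k. y (T * (real k / real m))) t"
    have "\<bar>?v \<bullet> b\<bar> \<le> d" if "b \<in> Basis" for b
    proof -
      have "t / T \<in> {0..1}" using t T by (auto simp: divide_simps)
      from bspec[OF bspec[OF * that] this] show ?thesis
        using T by (simp add: bernstein_interp_def inner_diff_left inner_sum_left mult.commute)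
    qed
    then have "norm ?v \<le> real DIM('b) * d"
      using norm_le_l1[of ?v] sum_bounded_above[of Basis "\<lambda>b. \<bar>?v \<bullet> b\<bar>" d] by simp
    also have "\<dots> < e" using e by (simp add: d_def)
    finally show "dist (bernstein_interp T m (\<lambda>k. y (T * (real k / real m))) t) (y t) < e"
      by (simp add: dist_norm norm_minus_commute)
  qed
qed

lemma bernstein_node_mem:
  assumes "0 < T" "k \<le> m"
  shows "T * (real k / real m) \<in> {0..T}"
proof -
  have "real k / real m \<le> 1" using assms(2) by (simp add: divide_le_eq)
  from mult_left_mono[OF this, of T] show ?thesis using assms(1) by auto
qed

text \<open>Brouwer's theorem is applied to the values of the unknown function at the nodes \<open>k T / m\<close>.\<close>

lemma bernstein_fixpoint:
  fixes \<Phi> :: "(real \<Rightarrow> 'b::euclidean_space) \<Rightarrow> real \<Rightarrow> 'b" and T R :: real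
  assumes T: "0 < T" and R: "0 < R"
    and bound: "\<And>q t. q \<in> cont_ball T (DIM('b) * R) \<Longrightarrow> t \<in> {0..T} \<Longrightarrow> norm (\<Phi> q t) \<le> R"
    and cont: "\<And>u q. (\<And>n. u n \<in> cont_ball T (DIM('b) * R)) \<Longrightarrow> q \<in> cont_ball T (DIM('b) * R) \<Longrightarrow>
        uniform_limit {0..T} u q sequentially \<Longrightarrow>
        uniform_limit {0..T} (\<lambda>n. \<Phi> (u n)) (\<Phi> q) sequentially"
  shows "\<exists>q \<in> cont_ball T (DIM('b) * R). q = bernstein_interp T m (\<lambda>k. \<Phi> q (T * (real k / real m)))"
proof -
  define node where "node x k = (\<Sum>b\<in>Basis. x (k, b) *\<^sub>R b)" for x :: "nat \<times> 'b \<Rightarrow> real" and k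
  define q where "q x = bernstein_interp T m (node x)" for x
  define F where "F x = (\<lambda>(k, b). \<Phi> (q x) (T * (real k / real m)) \<bullet> b)" for x
  define I where "I = {..m} \<times> (Basis :: 'b set)"
  have tk: "T * (real k / real m) \<in> {0..T}" if "k \<le> m" for k
    using bernstein_node_mem[OF T that] .
  have qball: "q x \<in> cont_ball T (DIM('b) * R)" if x: "\<forall>i\<in>I. x i \<in> {-R..R}" for x
  proof -
    \<comment> \<open>Coordinates bounded by \<open>R\<close> only give norm at most
      \<open>DIM('b) * R\<close>. Hence the larger ball on which \<open>\<Phi>\<close> must be
      controlled, although its values have norm at most \<open>R\<close>.\<close>
    have "norm (node x k) \<le> DIM('b) * R" if "k \<le> m" for k
      unfolding node_def
      by (rule order_trans[OF sum_norm_bound[where K = R]]) (use x that in \<open>force simp: I_def abs_le_iff\<close>)+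
    then show ?thesis
      using T unfolding cont_ball_def q_def
      by (auto intro!: continuous_on_bernstein_interp norm_bernstein_interp_le)
  qed
  obtain x where x: "\<And>i. i \<in> I \<Longrightarrow> x i \<in> {-R..R}" "\<And>i. i \<in> I \<Longrightarrow> F x i = x i"
  proof (rule brouwer_finite_cube[of I "-R" R F])
    show "finite I" by (auto simp: I_def)
    show "-R < R" using R by simp
    show "F x i \<in> {-R..R}" if x: "\<forall>j\<in>I. x j \<in> {-R..R}" and iI: "i \<in> I" for x i
    proof -
      obtain k b where i: "i = (k, b)" "k \<le> m" "b \<in> Basis" using iI by (auto simp: I_def)
      have "\<bar>F x i\<bar> \<le> norm (\<Phi> (q x) (T * (real k / real m)))"
        using i by (simp add: F_def Basis_le_norm)
      also have "\<dots> \<le> R" by (rule bound[OF qball[OF x] tk[OF i(2)]])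
      finally show ?thesis by auto
    qed
    fix u :: "nat \<Rightarrow> nat \<times> 'b \<Rightarrow> real" and x i
    assume u: "\<And>n. \<forall>j\<in>I. u n j \<in> {-R..R}" and ux: "\<And>j. j \<in> I \<Longrightarrow> (\<lambda>n. u n j) \<longlonglongrightarrow> x j" and i: "i \<in> I"
    have x: "\<forall>j\<in>I. x j \<in> {-R..R}"
      using closed_sequentially[OF closed_real_atLeastAtMost _ ux] u by blast
    have "uniform_limit {0..T} (\<lambda>n. q (u n)) (q x) sequentially"
    proof (rule uniform_limitI)
      fix e :: real assume e: "0 < e"
      have "(\<lambda>n. node (u n) k) \<longlonglongrightarrow> node x k" if "k \<le> m" for k
        unfolding node_def by (intro tendsto_intros ux) (use that in \<open>auto simp: I_def\<close>)
      then have "\<forall>\<^sub>F n in sequentially. \<forall>k\<in>{..m}. dist (node (u n) k) (node x k) < e / 2"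
        using e by (intro eventually_ball_finite ballI tendstoD) auto
      then show "\<forall>\<^sub>F n in sequentially. \<forall>t\<in>{0..T}. dist (q (u n) t) (q x t) < e"
      proof (rule eventually_mono, intro ballI)
        fix n t assume *: "\<forall>k\<in>{..m}. dist (node (u n) k) (node x k) < e / 2" and t: "t \<in> {0..T}"
        have "dist (q (u n) t) (q x t) \<le> e / 2"
          unfolding dist_norm q_def bernstein_interp_diff
          by (rule norm_bernstein_interp_le[OF T t]) (use * in \<open>auto simp: dist_norm intro: less_imp_le\<close>)
        then show "dist (q (u n) t) (q x t) < e" using e by simp
      qed
    qed
    from cont[OF qball[OF u] qball[OF x] this]
    have *: "uniform_limit {0..T} (\<lambda>n. \<Phi> (q (u n))) (\<Phi> (q x)) sequentially" .
    obtain k b where kb: "i = (k, b)" "k \<le> m" using i by (auto simp: I_def)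
    from tendsto_uniform_limitI[OF * tk[OF kb(2)]]
    show "(\<lambda>n. F (u n) i) \<longlonglongrightarrow> F x i"
      unfolding F_def kb(1) by (auto intro: tendsto_intros)
  qed blast
  have "node x k = \<Phi> (q x) (T * (real k / real m))" if k: "k \<le> m" for k
  proof (rule euclidean_eqI)
    fix b :: 'b assume b: "b \<in> Basis"
    have "node x k \<bullet> b = x (k, b)"
      using b unfolding node_def by (simp add: inner_sum_left inner_Basis if_distrib cong: if_cong)
    also have "\<dots> = \<Phi> (q x) (T * (real k / real m)) \<bullet> b"
      using x(2)[of "(k, b)"] k b by (simp add: I_def F_def)
    finally show "node x k \<bullet> b = \<Phi> (q x) (T * (real k / real m)) \<bullet> b" .
  qed
  then have "q x = bernstein_interp T m (\<lambda>k. \<Phi> (q x) (T * (real k / real m)))"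
    unfolding q_def bernstein_interp_def[abs_def] by (intro ext sum.cong) auto
  then show ?thesis using qball x(1) by blast
qed

section \<open>From Schauder's theorem to the Leray-Schauder alternative\<close>

text \<open>The approximate fixed points satisfy \<open>Q m = B (\<Phi> (Q m))\<close>, where
  \<open>B\<close> is Bernstein approximation. Compactness is extracted from the images
  \<open>\<Phi> (Q m)\<close>, which are bounded and equi-Lipschitz. A limit \<open>g\<close> of
  these is also the limit of \<open>Q m\<close> along the same subsequence, since \<open>B\<close>
  is nonexpansive and converges at the single function \<open>g\<close>; continuity of
  \<open>\<Phi>\<close> then gives \<open>\<Phi> g = g\<close>.\<close>

lemma schauder_lipschitz:
  fixes \<Phi> :: "(real \<Rightarrow> 'b::euclidean_space) \<Rightarrow> real \<Rightarrow> 'b" and T R :: real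
  assumes T: "0 < T" and R: "0 < R"
    and bound: "\<And>q t. q \<in> cont_ball T (DIM('b) * R) \<Longrightarrow> t \<in> {0..T} \<Longrightarrow> norm (\<Phi> q t) \<le> R"
    and lip: "\<And>q. q \<in> cont_ball T (DIM('b) * R) \<Longrightarrow> L-lipschitz_on {0..T} (\<Phi> q)"
    and cont: "\<And>u q. (\<And>n. u n \<in> cont_ball T (DIM('b) * R)) \<Longrightarrow> q \<in> cont_ball T (DIM('b) * R) \<Longrightarrow>
        uniform_limit {0..T} u q sequentially \<Longrightarrow>
        uniform_limit {0..T} (\<lambda>n. \<Phi> (u n)) (\<Phi> q) sequentially"
  shows "\<exists>q \<in> cont_ball T (DIM('b) * R). \<forall>t\<in>{0..T}. \<Phi> q t = q t"
proof -
  have "\<exists>q. q \<in> cont_ball T (DIM('b) * R) \<and>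
      q = bernstein_interp T (Suc m) (\<lambda>k. \<Phi> q (T * (real k / real (Suc m))))" for m
    using bernstein_fixpoint[where \<Phi> = \<Phi>, OF T R bound cont, of "Suc m"] by blast
  then obtain Q where Qb: "\<And>m. Q m \<in> cont_ball T (DIM('b) * R)"
    and Qeq: "\<And>m. Q m = bernstein_interp T (Suc m) (\<lambda>k. \<Phi> (Q m) (T * (real k / real (Suc m))))"
    by metis
  obtain g k where g: "continuous_on {0..T} g" and k: "strict_mono (k :: nat \<Rightarrow> nat)"
    and lim: "\<And>e. 0 < e \<Longrightarrow> \<exists>N. \<forall>n x. n \<ge> N \<and> x \<in> {0..T} \<longrightarrow> norm (\<Phi> (Q (k n)) x - g x) < e"
  proof (rule Arzela_Ascoli[of "{0..T}" "\<lambda>n. \<Phi> (Q n)" R])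
    show "norm (\<Phi> (Q n) x) \<le> R" if "x \<in> {0..T}" for n x
      by (rule bound[OF Qb that])
    fix x e :: real assume x: "x \<in> {0..T}" and e: "0 < e"
    have L: "0 \<le> L" using lipschitz_on_nonneg[OF lip[OF Qb]] .
    show "\<exists>d>0. \<forall>n y. y \<in> {0..T} \<and> norm (x - y) < d \<longrightarrow> norm (\<Phi> (Q n) x - \<Phi> (Q n) y) < e"
    \<comment> \<open>\<open>L\<close> may be 0, hence the denominator \<open>L + 1\<close>.\<close>
    proof (intro exI[of _ "e / (L + 1)"] conjI allI impI)
      fix n y assume y: "y \<in> {0..T} \<and> norm (x - y) < e / (L + 1)"
      have "norm (\<Phi> (Q n) x - \<Phi> (Q n) y) \<le> L * norm (x - y)"
        using lipschitz_onD[OF lip[OF Qb] x, of y n] y by (simp add: dist_norm)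
      also have "\<dots> \<le> (L + 1) * norm (x - y)" by (intro mult_right_mono) auto
      also have "\<dots> < e" using y L by (simp add: field_simps)
      finally show "norm (\<Phi> (Q n) x - \<Phi> (Q n) y) < e" .
    qed (use e L in auto)
  qed auto
  have \<Phi>g: "uniform_limit {0..T} (\<lambda>n. \<Phi> (Q (k n))) g sequentially"
    unfolding uniform_limit_sequentially_iff dist_norm using lim by blast
  have gb: "norm (g t) \<le> R" if t: "t \<in> {0..T}" for t
    by (rule LIMSEQ_le_const2[OF tendsto_norm[OF tendsto_uniform_limitI[OF \<Phi>g t]]])
       (use bound[OF Qb t] in auto)
  have DR: "R \<le> DIM('b) * R" using R by (simp add: Suc_leI)
  have gball: "g \<in> cont_ball T (DIM('b) * R)"
    using g gb DR unfolding cont_ball_def by force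
  have "strict_mono (\<lambda>n. Suc (k n))" using k by (simp add: strict_mono_def)
  then have "filterlim (\<lambda>n. Suc (k n)) sequentially sequentially"
    by (rule filterlim_subseq)
  from filterlim_compose[OF uniform_limit_bernstein_interp[OF T g] this]
  have bern: "uniform_limit {0..T} (\<lambda>n. bernstein_interp T (Suc (k n))
      (\<lambda>j. g (T * (real j / real (Suc (k n)))))) g sequentially" .
  have "uniform_limit {0..T} (\<lambda>n. Q (k n)) g sequentially"
  proof (rule uniform_limitI)
    fix e :: real assume e: "0 < e"
    have "\<forall>\<^sub>F n in sequentially. \<forall>t\<in>{0..T}. dist (\<Phi> (Q (k n)) t) (g t) < e / 2"
      "\<forall>\<^sub>F n in sequentially. \<forall>t\<in>{0..T}.
        dist (bernstein_interp T (Suc (k n)) (\<lambda>j. g (T * (real j / real (Suc (k n))))) t) (g t) < e / 2"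
      by (rule uniform_limitD[OF \<Phi>g half_gt_zero[OF e]], rule uniform_limitD[OF bern half_gt_zero[OF e]])
    then show "\<forall>\<^sub>F n in sequentially. \<forall>t\<in>{0..T}. dist (Q (k n) t) (g t) < e"
    proof eventually_elim
      case (elim n)
      show ?case
      proof
        fix t assume t: "t \<in> {0..T}"
        let ?b = "bernstein_interp T (Suc (k n)) (\<lambda>j. g (T * (real j / real (Suc (k n))))) t"
        let ?c = "bernstein_interp T (Suc (k n)) (\<lambda>j. \<Phi> (Q (k n)) (T * (real j / real (Suc (k n))))) t"
        have "Q (k n) t = ?c" by (rule fun_cong[OF Qeq])
        moreover have "norm (?c - ?b) \<le> e / 2"
          unfolding bernstein_interp_diff
        proof (rule norm_bernstein_interp_le[OF T t])
          fix j assume "j \<le> Suc (k n)"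
          then have "T * (real j / real (Suc (k n))) \<in> {0..T}"
            by (rule bernstein_node_mem[OF T])
          then show "norm (\<Phi> (Q (k n)) (T * (real j / real (Suc (k n)))) - g (T * (real j / real (Suc (k n))))) \<le> e / 2"
            using elim(1) by (metis dist_norm less_imp_le)
        qed
        moreover have "dist ?b (g t) < e / 2" using elim(2) t by blast
        ultimately show "dist (Q (k n) t) (g t) < e"
          using dist_triangle[of "Q (k n) t" "g t" ?b] by (simp only: dist_norm)
      qed
    qed
  qed
  from cont[OF Qb gball this]
  have "uniform_limit {0..T} (\<lambda>n. \<Phi> (Q (k n))) (\<Phi> g) sequentially" .
  then have "\<Phi> g t = g t" if "t \<in> {0..T}" for t
    using LIMSEQ_unique tendsto_uniform_limitI[OF _ that] \<Phi>g by metis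
  then show ?thesis using gball by blast
qed


text \<open>One direction of the 1-Lipschitz property of the sup norm. Used both ways, it makes the
  scaling factor of the radial retraction continuous.\<close>

lemma SUP_norm_diff_le:
  fixes f g :: "'a \<Rightarrow> 'b::real_normed_vector"
  assumes "A \<noteq> {}" "\<And>t. t \<in> A \<Longrightarrow> norm (f t - g t) \<le> e"
    and "\<And>t. t \<in> A \<Longrightarrow> norm (g t) \<le> B"
  shows "(SUP t\<in>A. norm (f t)) \<le> (SUP t\<in>A. norm (g t)) + e"
proof (rule cSUP_least[OF assms(1)])
  fix t assume t: "t \<in> A"
  have "norm (f t) \<le> norm (g t) + norm (f t - g t)"
    using norm_triangle_ineq[of "g t" "f t - g t"] by simp
  also have "norm (g t) \<le> (SUP t\<in>A. norm (g t))"
    by (rule cSUP_upper[OF t]) (use assms(3) in \<open>auto intro!: bdd_aboveI2\<close>)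
  finally show "norm (f t) \<le> (SUP t\<in>A. norm (g t)) + e"
    using assms(2)[OF t] by simp
qed

text \<open>Composing \<open>G\<close> with the radial retraction onto the ball of radius \<open>R\<close> produces a map to
  which Schauder's theorem applies; a fixed point at which the retraction acts nontrivially would be
  a solution of \<open>q = lam G q\<close> of norm exactly \<open>R\<close>.\<close>

theorem leray_schauder_lipschitz:
  fixes G :: "(real \<Rightarrow> 'b::euclidean_space) \<Rightarrow> real \<Rightarrow> 'b" and T R :: real
  assumes T: "0 < T" and R: "0 < R"
    and bound: "\<And>K. \<exists>B. \<forall>q \<in> cont_ball T K. \<forall>t\<in>{0..T}. norm (G q t) \<le> B"
    and lip: "\<And>K. \<exists>L. \<forall>q \<in> cont_ball T K. L-lipschitz_on {0..T} (G q)"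
    and cont: "\<And>K u q. (\<And>n. u n \<in> cont_ball T K) \<Longrightarrow> q \<in> cont_ball T K \<Longrightarrow>
        uniform_limit {0..T} u q sequentially \<Longrightarrow>
        uniform_limit {0..T} (\<lambda>n. G (u n)) (G q) sequentially"
    and apriori: "\<And>q lam t. continuous_on {0..T} q \<Longrightarrow> 0 < lam \<Longrightarrow> lam \<le> 1 \<Longrightarrow>
        (\<And>t. t \<in> {0..T} \<Longrightarrow> q t = lam *\<^sub>R G q t) \<Longrightarrow> t \<in> {0..T} \<Longrightarrow> norm (q t) < R"
  shows "\<exists>q. continuous_on {0..T} q \<and> (\<forall>t\<in>{0..T}. G q t = q t)"
proof -
  define K where "K = DIM('b) * R"
  obtain B where B: "\<And>q t. q \<in> cont_ball T K \<Longrightarrow> t \<in> {0..T} \<Longrightarrow> norm (G q t) \<le> B"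
    using bound[of K] by blast
  obtain L where L: "\<And>q. q \<in> cont_ball T K \<Longrightarrow> L-lipschitz_on {0..T} (G q)"
    using lip[of K] by blast
  have T0: "{0..T} \<noteq> {}" using T by auto
  define nrm where "nrm q = (SUP t\<in>{0..T}. norm (G q t))" for q
  \<comment> \<open>The retraction factor; it is also the \<open>lam\<close> for which the a priori
    bound is invoked below.\<close>
  define s where "s q = R / max R (nrm q)" for q
  have s: "0 < s q" "s q \<le> 1" for q using R by (auto simp: s_def divide_simps)
  have nrm: "norm (G q t) \<le> nrm q" if "q \<in> cont_ball T K" "t \<in> {0..T}" for q t
    unfolding nrm_def by (rule cSUP_upper[OF that(2)]) (use B[OF that(1)] in \<open>auto intro!: bdd_aboveI2[where M = B]\<close>)
  have "\<exists>q \<in> cont_ball T (DIM('b) * R). \<forall>t\<in>{0..T}. s q *\<^sub>R G q t = q t"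
  proof (rule schauder_lipschitz[OF T R, where L = L], unfold K_def[symmetric])
    fix q :: "real \<Rightarrow> 'b" assume q: "q \<in> cont_ball T K"
    show "norm (s q *\<^sub>R G q t) \<le> R" if t: "t \<in> {0..T}" for t
    proof -
      have "norm (s q *\<^sub>R G q t) \<le> s q * max R (nrm q)"
        using nrm[OF q t] s[of q] by (auto intro!: mult_left_mono)
      also have "\<dots> = R" using R by (simp add: s_def)
      finally show ?thesis .
    qed
    show "L-lipschitz_on {0..T} (\<lambda>t. s q *\<^sub>R G q t)"
    proof (rule lipschitz_onI)
      show "0 \<le> L" by (rule lipschitz_on_nonneg[OF L[OF q]])
      fix x y assume xy: "x \<in> {0..T}" "y \<in> {0..T}"
      have "dist (s q *\<^sub>R G q x) (s q *\<^sub>R G q y) = s q * dist (G q x) (G q y)"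
        using s[of q] by (simp add: dist_norm flip: scaleR_diff_right)
      also have "\<dots> \<le> 1 * dist (G q x) (G q y)"
        using s[of q] by (intro mult_right_mono) auto
      also have "\<dots> \<le> L * dist x y" using lipschitz_onD[OF L[OF q] xy] by simp
      finally show "dist (s q *\<^sub>R G q x) (s q *\<^sub>R G q y) \<le> L * dist x y" .
    qed
  next
    fix u and q :: "real \<Rightarrow> 'b"
    assume u: "\<And>n. u n \<in> cont_ball T K" and q: "q \<in> cont_ball T K"
      and lim: "uniform_limit {0..T} u q sequentially"
    have G: "uniform_limit {0..T} (\<lambda>n. G (u n)) (G q) sequentially" by (rule cont[OF u q lim])
    have "(\<lambda>n. nrm (u n)) \<longlonglongrightarrow> nrm q"
    proof (rule tendstoI)
      fix e :: real assume "0 < e"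
      then have "0 < e / 2" by simp
      from uniform_limitD[OF G this] show "\<forall>\<^sub>F n in sequentially. dist (nrm (u n)) (nrm q) < e"
      proof eventually_elim
        case (elim n)
        have "nrm (u n) \<le> nrm q + e / 2"
          unfolding nrm_def
          by (rule SUP_norm_diff_le[OF T0 _ B[OF q]]) (use elim in \<open>auto simp: dist_norm intro: less_imp_le\<close>)
        moreover have "nrm q \<le> nrm (u n) + e / 2"
          unfolding nrm_def
          by (rule SUP_norm_diff_le[OF T0 _ B[OF u]])
             (use elim in \<open>auto simp: dist_norm norm_minus_commute intro: less_imp_le\<close>)
        ultimately show ?case using \<open>0 < e\<close> by (auto simp: dist_real_def)
      qed
    qed
    then have "(\<lambda>n. s (u n)) \<longlonglongrightarrow> s q"
      unfolding s_def using R by (intro tendsto_intros) auto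
    then have "uniform_limit {0..T} (\<lambda>n t. s (u n)) (\<lambda>t. s q) sequentially"
      unfolding uniform_limit_iff tendsto_iff by auto
    moreover have "bounded ((\<lambda>t. s q) ` {0..T})" "bounded (G q ` {0..T})"
      using B[OF q] by (auto simp: bounded_iff intro: exI[of _ "\<bar>s q\<bar>"] exI[of _ B])
    ultimately show "uniform_limit {0..T} (\<lambda>n t. s (u n) *\<^sub>R G (u n) t) (\<lambda>t. s q *\<^sub>R G q t) sequentially"
      by (intro bounded_bilinear.bounded_uniform_limit[OF bounded_bilinear_scaleR _ G])
  qed
  then obtain q where q: "q \<in> cont_ball T K" and fp: "\<And>t. t \<in> {0..T} \<Longrightarrow> s q *\<^sub>R G q t = q t"
    unfolding K_def by blast
  have qc: "continuous_on {0..T} q" using q by (simp add: cont_ball_def)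
  have "nrm q \<le> R"
  proof (rule ccontr)
    assume "\<not> nrm q \<le> R"
    have "compact ((\<lambda>t. norm (q t)) ` {0..T})"
      by (intro compact_continuous_image continuous_intros qc) auto
    from compact_attains_sup[OF this] T0 obtain t where t: "t \<in> {0..T}"
      and max: "\<And>t'. t' \<in> {0..T} \<Longrightarrow> norm (q t') \<le> norm (q t)"
      by auto
    have "nrm q \<le> norm (q t) / s q"
      unfolding nrm_def
    proof (rule cSUP_least[OF T0])
      fix t' assume t': "t' \<in> {0..T}"
      have "s q * norm (G q t') = norm (q t')"
        using s[of q] by (simp flip: fp[OF t'])
      also have "\<dots> \<le> norm (q t)" by (rule max[OF t'])
      finally show "norm (G q t') \<le> norm (q t) / s q"
        using s[of q] by (simp add: field_simps)
    qed
    then have "s q * nrm q \<le> norm (q t)" using s[of q] by (simp add: field_simps)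
    moreover have "s q * nrm q = R" using \<open>\<not> nrm q \<le> R\<close> R by (simp add: s_def)
    moreover have "norm (q t) < R"
      by (rule apriori[OF qc s(1)[of q] s(2)]) (use fp t in auto)
    ultimately show False by simp
  qed
  then have "s q = 1" using R by (simp add: s_def)
  then show ?thesis using fp qc by auto
qed

subsection \<open>Periodic means and mean-zero antiderivatives\<close>

text \<open>A Lipschitz estimate in the sup norm, phrased with arbitrary upper bounds
  \<open>K\<close> so that no norm on functions has to be introduced.\<close>

lemma uniform_limit_bounded_operator:
  fixes u :: "nat \<Rightarrow> 'a \<Rightarrow> 'b::real_normed_vector" and F :: "('a \<Rightarrow> 'b) \<Rightarrow> 'c \<Rightarrow> 'd::real_normed_vector"
  assumes lim: "uniform_limit A u q sequentially" and c: "0 < c"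
    and le: "\<And>n K. (\<And>t. t \<in> A \<Longrightarrow> norm (u n t - q t) \<le> K) \<Longrightarrow>
        (\<And>t. t \<in> B \<Longrightarrow> norm (F (u n) t - F q t) \<le> c * K)"
  shows "uniform_limit B (\<lambda>n. F (u n)) (F q) sequentially"
proof (rule uniform_limitI)
  fix e :: real assume e: "0 < e"
  then have "0 < e / (2 * c)" using c by simp
  from uniform_limitD[OF lim this]
  show "\<forall>\<^sub>F n in sequentially. \<forall>t\<in>B. dist (F (u n) t) (F q t) < e"
  proof eventually_elim
    case (elim n)
    show ?case
    proof
      fix t assume t: "t \<in> B"
      have "norm (F (u n) t - F q t) \<le> c * (e / (2 * c))"
        by (rule le[OF _ t]) (use elim in \<open>auto simp: dist_norm intro: less_imp_le\<close>)
      also have "\<dots> < e" using c e by simp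
      finally show "dist (F (u n) t) (F q t) < e" by (simp add: dist_norm)
    qed
  qed
qed

lemma lipschitz_on_vector_derivative:
  fixes g :: "real \<Rightarrow> 'b::real_normed_vector"
  assumes "\<And>t. t \<in> {a..b} \<Longrightarrow> (g has_vector_derivative g' t) (at t within {a..b})"
    and "\<And>t. t \<in> {a..b} \<Longrightarrow> norm (g' t) \<le> L" "0 \<le> L"
  shows "L-lipschitz_on {a..b} g"
proof (rule bounded_derivative_imp_lipschitz)
  show "(g has_derivative (\<lambda>h. h *\<^sub>R g' t)) (at t within {a..b})" if "t \<in> {a..b}" for t
    using assms(1)[OF that] by (simp add: has_vector_derivative_def)
  show "onorm (\<lambda>h. h *\<^sub>R g' t) \<le> L" if "t \<in> {a..b}" for t
    by (rule onorm_le) (use mult_left_mono[OF assms(2)[OF that] abs_ge_zero] in \<open>auto simp: mult.commute\<close>)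
qed (use assms(3) in auto)

text \<open>The inverse of \<open>d/dt\<close> on mean-zero periodic functions, preceded by the
  projection that removes the mean. Subtracting the mean of \<open>g\<close> makes the
  antiderivative periodic; the second subtraction fixes the constant of integration.\<close>

definition zm_antideriv :: "real \<Rightarrow> (real \<Rightarrow> real ^ 'n) \<Rightarrow> real \<Rightarrow> real ^ 'n" where
  "zm_antideriv T g t =
     integral {0..t} (\<lambda>s. g s - period_mean T g)
     - period_mean T (\<lambda>t. integral {0..t} (\<lambda>s. g s - period_mean T g))"

context
  fixes T :: real
  assumes T: "0 < T"
begin

lemma period_mean_const: "period_mean T (\<lambda>t. c) = c"
  using T by (simp add: period_mean_def)

lemma period_mean_cong: "(\<And>t. t \<in> {0..T} \<Longrightarrow> g t = h t) \<Longrightarrow> period_mean T g = period_mean T h"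
  using integral_cong[of "{0..T}" g h] by (simp add: period_mean_def)

lemma period_mean_diff:
  "continuous_on {0..T} g \<Longrightarrow> continuous_on {0..T} h \<Longrightarrow>
    period_mean T (\<lambda>t. g t - h t) = period_mean T g - period_mean T h"
  by (simp add: period_mean_def integral_diff integrable_continuous_real scaleR_diff_right)

lemma period_mean_add:
  "continuous_on {0..T} g \<Longrightarrow> continuous_on {0..T} h \<Longrightarrow>
    period_mean T (\<lambda>t. g t + h t) = period_mean T g + period_mean T h"
  by (simp add: period_mean_def integral_add integrable_continuous_real scaleR_add_right)

lemma period_mean_linear:
  assumes "bounded_linear L" "continuous_on {0..T} g"
  shows "period_mean T (\<lambda>t. L (g t)) = L (period_mean T g)"
  using integral_linear[OF integrable_continuous_real[OF assms(2)] assms(1)]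
    linear_scale[OF bounded_linear.linear[OF assms(1)]]
  by (simp add: period_mean_def o_def)

lemma norm_period_mean_le:
  assumes "continuous_on {0..T} g" "\<And>t. t \<in> {0..T} \<Longrightarrow> norm (g t) \<le> K"
  shows "norm (period_mean T g) \<le> K"
  using integral_bound[OF _ assms(1), of K] assms(2) T
  by (auto simp: period_mean_def divide_simps mult.commute)

lemma continuous_on_integral_centered:
  fixes g :: "real \<Rightarrow> 'b::banach"
  assumes "continuous_on {0..T} g"
  shows "continuous_on {0..T} (\<lambda>t. integral {0..t} (\<lambda>s. g s - c))"
proof -
  have "(\<lambda>s. g s - c) integrable_on {0..T}"
    by (intro integrable_continuous_real continuous_on_diff continuous_on_const assms)
  then show ?thesis by (rule indefinite_integral_continuous_1)
qed

lemma zm_antideriv_has_vector_derivative: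
  assumes "continuous_on {0..T} g" "t \<in> {0..T}"
  shows "(zm_antideriv T g has_vector_derivative g t - period_mean T g) (at t within {0..T})"
proof -
  have "continuous_on {0..T} (\<lambda>s. g s - period_mean T g)"
    by (intro continuous_intros assms)
  from has_vector_derivative_diff[OF integral_has_vector_derivative[OF this assms(2)] has_vector_derivative_const]
  show ?thesis unfolding zm_antideriv_def[abs_def] by simp
qed

lemma continuous_on_zm_antideriv:
  "continuous_on {0..T} g \<Longrightarrow> continuous_on {0..T} (zm_antideriv T g)"
  by (rule continuous_on_vector_derivative[OF zm_antideriv_has_vector_derivative])

lemma zm_antideriv_periodic:
  assumes "continuous_on {0..T} g"
  shows "zm_antideriv T g T = zm_antideriv T g 0"
  using T assms
  by (simp add: zm_antideriv_def integral_diff integrable_continuous_real) (simp add: period_mean_def)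

lemma period_mean_zm_antideriv:
  assumes "continuous_on {0..T} g"
  shows "period_mean T (zm_antideriv T g) = 0"
  unfolding zm_antideriv_def[abs_def]
  by (subst period_mean_diff) (auto simp: period_mean_const intro!: continuous_on_integral_centered assms)

lemma zm_antideriv_diff:
  assumes "continuous_on {0..T} g" "continuous_on {0..T} h" "t \<in> {0..T}"
  shows "zm_antideriv T g t - zm_antideriv T h t = zm_antideriv T (\<lambda>t. g t - h t) t"
proof -
  have *: "integral {0..t} (\<lambda>s. g s - h s - period_mean T (\<lambda>t. g t - h t)) =
    integral {0..t} (\<lambda>s. g s - period_mean T g) - integral {0..t} (\<lambda>s. h s - period_mean T h)"
    if "t \<in> {0..T}" for t
    by (subst integral_diff[symmetric])
      (use that in \<open>auto intro!: integrable_continuous_real continuous_intros continuous_on_subset[OF assms(1)]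
          continuous_on_subset[OF assms(2)] simp: period_mean_diff[OF assms(1,2)] algebra_simps\<close>)
  have "period_mean T (\<lambda>t. integral {0..t} (\<lambda>s. g s - h s - period_mean T (\<lambda>t. g t - h t))) =
     period_mean T (\<lambda>t. integral {0..t} (\<lambda>s. g s - period_mean T g) - integral {0..t} (\<lambda>s. h s - period_mean T h))"
    by (rule period_mean_cong) (rule *)
  then show ?thesis
    unfolding zm_antideriv_def using *[OF assms(3)]
    by (simp add: period_mean_diff continuous_on_integral_centered assms)
qed

text \<open>Removing the mean of \<open>g\<close> at most doubles its bound, integration contributes
  \<open>T\<close>, and removing the mean of the integral doubles again.\<close>

lemma norm_zm_antideriv_le:
  assumes g: "continuous_on {0..T} g" and K: "\<And>t. t \<in> {0..T} \<Longrightarrow> norm (g t) \<le> K" and t: "t \<in> {0..T}"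
  shows "norm (zm_antideriv T g t) \<le> 4 * T * K"
proof -
  have K0: "0 \<le> K" using order_trans[OF norm_ge_zero K[of 0]] T by simp
  have gm: "norm (g s - period_mean T g) \<le> 2 * K" if "s \<in> {0..T}" for s
    using norm_triangle_ineq4[of "g s" "period_mean T g"] K[OF that] norm_period_mean_le[OF g K] by auto
  have *: "norm (integral {0..t} (\<lambda>s. g s - period_mean T g)) \<le> 2 * T * K" if t: "t \<in> {0..T}" for t
  proof -
    have "norm (integral {0..t} (\<lambda>s. g s - period_mean T g)) \<le> 2 * K * (t - 0)"
      by (rule integral_bound) (use t gm in \<open>auto intro!: continuous_intros continuous_on_subset[OF g]\<close>)
    also have "\<dots> \<le> 2 * K * T" using t K0 by (intro mult_left_mono) auto
    finally show ?thesis by (simp add: mult_ac)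
  qed
  have "norm (period_mean T (\<lambda>t. integral {0..t} (\<lambda>s. g s - period_mean T g))) \<le> 2 * T * K"
    by (rule norm_period_mean_le[OF continuous_on_integral_centered[OF g] *])
  then show ?thesis
    unfolding zm_antideriv_def by (rule order_trans[OF norm_triangle_ineq4 order_trans[OF add_mono[OF *[OF t]]]]) simp
qed

lemma uniform_limit_period_mean:
  assumes u: "\<And>n. continuous_on {0..T} (u n)" and q: "continuous_on {0..T} q"
    and lim: "uniform_limit {0..T} u q sequentially"
  shows "uniform_limit A (\<lambda>n t. period_mean T (u n)) (\<lambda>t. period_mean T q) sequentially"
proof (rule uniform_limit_bounded_operator[OF lim zero_less_one, where F = "\<lambda>u t. period_mean T u"])
  fix n K t assume "\<And>t. t \<in> {0..T} \<Longrightarrow> norm (u n t - q t) \<le> K"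
  then show "norm (period_mean T (u n) - period_mean T q) \<le> 1 * K"
    unfolding period_mean_diff[OF u q, symmetric]
    by (auto intro!: norm_period_mean_le continuous_on_diff u q)
qed

lemma uniform_limit_zm_antideriv:
  assumes u: "\<And>n. continuous_on {0..T} (u n)" and q: "continuous_on {0..T} q"
    and lim: "uniform_limit {0..T} u q sequentially"
  shows "uniform_limit {0..T} (\<lambda>n. zm_antideriv T (u n)) (zm_antideriv T q) sequentially"
proof (rule uniform_limit_bounded_operator[OF lim])
  show "0 < 4 * T" using T by simp
  fix n K t assume *: "\<And>t. t \<in> {0..T} \<Longrightarrow> norm (u n t - q t) \<le> K" and t: "t \<in> {0..T}"
  then show "norm (zm_antideriv T (u n) t - zm_antideriv T q t) \<le> 4 * T * K"
    unfolding zm_antideriv_diff[OF u q t]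
    by (intro norm_zm_antideriv_le continuous_on_diff u q)
qed

end

subsection \<open>The periodic boundary value problem\<close>

text \<open>Rolle's theorem for component \<open>j\<close> of the mean-zero antiderivative, which
  has equal values at both ends. The time depends on \<open>j\<close>: a common time for all
  components need not exist.\<close>

lemma period_mean_mvt:
  assumes T: "0 < T" and g: "continuous_on {0..T} g"
  obtains t where "t \<in> {0..T}" "g t $ j = period_mean T g $ j"
proof -
  let ?h = "\<lambda>t. zm_antideriv T g t $ j"
  have der: "((\<lambda>t. zm_antideriv T g t $ j) has_derivative (\<lambda>x. x * (g t - period_mean T g) $ j)) (at t)"
    if "0 < t" "t < T" for t
    using bounded_linear.has_vector_derivative[OF bounded_linear_vec_nth
        zm_antideriv_has_vector_derivative[OF T g], of t j] that
    by (simp add: has_vector_derivative_def at_within_Icc_at)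
  have "\<exists>z>0. z < T \<and> (\<lambda>x. x * (g z - period_mean T g) $ j) = (\<lambda>v. 0)"
  proof (rule Rolle_deriv[OF T])
    show "?h 0 = ?h T" by (simp add: zm_antideriv_periodic[OF T g])
    show "continuous_on {0..T} ?h"
      by (intro continuous_intros continuous_on_zm_antideriv[OF T g])
  qed (rule der)
  then obtain z where "0 < z" "z < T" "(g z - period_mean T g) $ j = 0"
    by (metis mult_1)
  then show ?thesis using that[of z] by simp
qed

section \<open>The integral operator and its compactness\<close>

text \<open>\<open>sg\<close> stands for the sign of the definite form of \<open>C\<close>, and
  \<open>eps j\<close> for the sign in the condition on coordinate \<open>j\<close>, so both
  alternatives of each hypothesis are handled at once. Everything lives on one closed period, hence
  \<open>f T = f 0\<close>.\<close>

locale forced_system =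
  fixes M Mi C :: "real ^ 'n ^ 'n" and S :: "real ^ 'n \<Rightarrow> real ^ 'n" and f :: "real \<Rightarrow> real ^ 'n"
    and V :: "real ^ 'n \<Rightarrow> real" and eps :: "'n \<Rightarrow> real" and T C0 sg r :: real
  assumes T: "0 < T"
    and M_sym: "transpose M = M" and MMi: "M ** Mi = mat 1"
    and S: "continuous_on UNIV S"
    and f: "continuous_on {0..T} f" and f_per: "f T = f 0"
    and C0: "0 < C0" and sg: "\<bar>sg\<bar> = 1"
    and damping: "\<And>x. C0 * (norm x)\<^sup>2 \<le> sg * (x \<bullet> (C *v x))"
    and V: "\<And>q. GDERIV V q :> S q"
    and r: "0 < r" and eps: "\<And>j. eps j \<noteq> 0"
    and restoring: "\<And>q j. r < \<bar>q $ j\<bar> \<Longrightarrow> 0 < eps j * (q $ j * (S q $ j - period_mean T f $ j))"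
begin

definition N :: "(real \<Rightarrow> real ^ 'n) \<Rightarrow> real \<Rightarrow> real ^ 'n" where
  "N q t = S (q t) - f t"

definition D :: "real ^ 'n \<Rightarrow> real ^ 'n" where
  "D x = (\<chi> j. eps j * x $ j)"

text \<open>Formally the double mean-free antiderivative of \<open>C q' + N q\<close>, with
  \<open>C q'\<close> already integrated once, so that \<open>q\<close> need only be
  continuous.\<close>

definition W :: "(real \<Rightarrow> real ^ 'n) \<Rightarrow> real \<Rightarrow> real ^ 'n" where
  "W q t = zm_antideriv T (\<lambda>t. C *v q t) t + zm_antideriv T (zm_antideriv T (N q)) t"

text \<open>\<open>W q\<close> has mean zero, so the first two terms form the mean of
  \<open>G q\<close>: a fixed point satisfies \<open>D (mean (N q)) = 0\<close>, while its
  oscillating part solves the twice integrated equation.\<close>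

definition G :: "(real \<Rightarrow> real ^ 'n) \<Rightarrow> real \<Rightarrow> real ^ 'n" where
  "G q t = period_mean T q - D (period_mean T (N q)) - Mi *v W q t"

lemmas blin = matrix_vector_mul_bounded_linear

lemma bounded_linear_D: "bounded_linear D"
  unfolding linear_conv_bounded_linear[symmetric]
  by (rule linearI) (simp_all add: D_def vec_eq_iff algebra_simps)

lemma continuous_on_mult_C: "continuous_on A q \<Longrightarrow> continuous_on A (\<lambda>t. C *v q t)"
  by (rule bounded_linear.continuous_on[OF blin])

lemma continuous_on_N: "continuous_on {0..T} q \<Longrightarrow> continuous_on {0..T} (N q)"
  unfolding N_def by (intro continuous_on_diff f continuous_on_compose2[OF S]) auto

lemma cont_ballD:
  assumes "q \<in> cont_ball T K"
  shows "continuous_on {0..T} q" "t \<in> {0..T} \<Longrightarrow> norm (q t) \<le> K"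
  using assms by (auto simp: cont_ball_def)

lemma f_bounded: "\<exists>F\<ge>0. \<forall>t\<in>{0..T}. norm (f t) \<le> F"
proof -
  have "bounded (f ` {0..T})"
    by (intro compact_imp_bounded compact_continuous_image f) auto
  then obtain F where "0 < F" "\<forall>x\<in>f ` {0..T}. norm x \<le> F"
    by (auto simp: bounded_pos)
  then show ?thesis by (intro exI[of _ F]) auto
qed

lemma N_bounded: "\<exists>B. \<forall>q \<in> cont_ball T K. \<forall>t\<in>{0..T}. norm (N q t) \<le> B"
proof -
  obtain F where F: "\<And>t. t \<in> {0..T} \<Longrightarrow> norm (f t) \<le> F" using f_bounded by blast
  have "bounded (S ` cball 0 K)"
    by (intro compact_imp_bounded compact_continuous_image continuous_on_subset[OF S]) auto
  then obtain B where "\<forall>x\<in>S ` cball 0 K. norm x \<le> B"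
    unfolding bounded_iff by blast
  then have B: "norm (S x) \<le> B" if "norm x \<le> K" for x
    using that by simp
  have "norm (N q t) \<le> B + F" if q: "q \<in> cont_ball T K" and t: "t \<in> {0..T}" for q t
    unfolding N_def
    by (rule order_trans[OF norm_triangle_ineq4 add_mono[OF B[OF cont_ballD(2)[OF q t]] F[OF t]]])
  then show ?thesis by blast
qed

lemma mult_C_bounded: "\<exists>B. \<forall>q \<in> cont_ball T K. \<forall>t\<in>{0..T}. norm (C *v q t) \<le> B"
proof -
  obtain B where B: "0 \<le> B" "\<And>x. norm (C *v x) \<le> norm x * B"
    using bounded_linear.nonneg_bounded[OF blin[of C]] by blast
  have "norm (C *v q t) \<le> K * B" if q: "q \<in> cont_ball T K" and t: "t \<in> {0..T}" for q t
    by (rule order_trans[OF B(2) mult_right_mono[OF cont_ballD(2)[OF q t] B(1)]])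
  then show ?thesis by blast
qed

lemma G_bounded: "\<exists>B. \<forall>q \<in> cont_ball T K. \<forall>t\<in>{0..T}. norm (G q t) \<le> B"
proof -
  obtain BN where BN: "\<And>q t. q \<in> cont_ball T K \<Longrightarrow> t \<in> {0..T} \<Longrightarrow> norm (N q t) \<le> BN"
    using N_bounded[of K] by blast
  obtain BC where BC: "\<And>q t. q \<in> cont_ball T K \<Longrightarrow> t \<in> {0..T} \<Longrightarrow> norm (C *v q t) \<le> BC"
    using mult_C_bounded[of K] by blast
  obtain d where d: "0 \<le> d" "\<And>x. norm (D x) \<le> norm x * d"
    using bounded_linear.nonneg_bounded[OF bounded_linear_D] by blast
  obtain m where m: "0 \<le> m" "\<And>x. norm (Mi *v x) \<le> norm x * m"
    using bounded_linear.nonneg_bounded[OF blin[of Mi]] by blast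
  have "norm (G q t) \<le> K + BN * d + (4 * T * BC + 4 * T * (4 * T * BN)) * m"
    if q: "q \<in> cont_ball T K" and t: "t \<in> {0..T}" for q t
  proof -
    note qc = cont_ballD(1)[OF q]
    have "norm (period_mean T q) \<le> K"
      by (rule norm_period_mean_le[OF T qc cont_ballD(2)[OF q]])
    moreover have "norm (D (period_mean T (N q))) \<le> BN * d"
      by (rule order_trans[OF d(2) mult_right_mono[OF norm_period_mean_le[OF T continuous_on_N[OF qc] BN[OF q]] d(1)]])
    moreover have "norm (W q t) \<le> 4 * T * BC + 4 * T * (4 * T * BN)"
      unfolding W_def
      by (intro order_trans[OF norm_triangle_ineq] add_mono norm_zm_antideriv_le[OF T] t qc
          continuous_on_mult_C continuous_on_zm_antideriv[OF T] continuous_on_N BC[OF q] BN[OF q])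
    then have "norm (Mi *v W q t) \<le> (4 * T * BC + 4 * T * (4 * T * BN)) * m"
      by (rule order_trans[OF m(2) mult_right_mono[OF _ m(1)]])
    ultimately show ?thesis
      unfolding G_def by (intro order_trans[OF norm_triangle_ineq4] add_mono)
  qed
  then show ?thesis by blast
qed

text \<open>The inner antiderivative in the second summand has mean zero, so only
  \<open>C *v q\<close> leaves a mean to subtract.\<close>

lemma W_has_vector_derivative:
  assumes q: "continuous_on {0..T} q" and t: "t \<in> {0..T}"
  shows "(W q has_vector_derivative (C *v q t - C *v period_mean T q + zm_antideriv T (N q) t)) (at t within {0..T})"
  using has_vector_derivative_add[OF
      zm_antideriv_has_vector_derivative[OF T continuous_on_mult_C[OF q] t]
      zm_antideriv_has_vector_derivative[OF T continuous_on_zm_antideriv[OF T continuous_on_N[OF q]] t]]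
  unfolding W_def[abs_def] period_mean_zm_antideriv[OF T continuous_on_N[OF q]] period_mean_linear[OF T blin q]
  by simp

lemma continuous_on_W: "continuous_on {0..T} q \<Longrightarrow> continuous_on {0..T} (W q)"
  by (rule continuous_on_vector_derivative[OF W_has_vector_derivative])

lemma W_periodic:
  assumes "continuous_on {0..T} q" shows "W q T = W q 0"
  by (simp add: W_def zm_antideriv_periodic[OF T] continuous_on_mult_C continuous_on_N
      continuous_on_zm_antideriv[OF T] assms)

lemma period_mean_W:
  assumes "continuous_on {0..T} q" shows "period_mean T (W q) = 0"
  unfolding W_def[abs_def]
  by (simp add: period_mean_add[OF T] period_mean_zm_antideriv[OF T] continuous_on_mult_C continuous_on_N
      continuous_on_zm_antideriv[OF T] assms)

lemma G_has_vector_derivative: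
  assumes q: "continuous_on {0..T} q" and t: "t \<in> {0..T}"
  shows "(G q has_vector_derivative - (Mi *v (C *v q t - C *v period_mean T q + zm_antideriv T (N q) t)))
      (at t within {0..T})"
  using has_vector_derivative_diff[OF has_vector_derivative_const
      bounded_linear.has_vector_derivative[OF blin W_has_vector_derivative[OF q t]]]
  unfolding G_def[abs_def] by simp

text \<open>The derivative of \<open>G q\<close> involves no derivative of \<open>q\<close>, so a
  sup bound on \<open>q\<close> controls it. This gain of regularity is the source of
  compactness.\<close>

lemma G_lipschitz: "\<exists>L. \<forall>q \<in> cont_ball T K. L-lipschitz_on {0..T} (G q)"
proof (cases "cont_ball T K = ({} :: (real \<Rightarrow> real ^ 'n) set)")
  case False
  obtain BN where BN: "\<And>q t. q \<in> cont_ball T K \<Longrightarrow> t \<in> {0..T} \<Longrightarrow> norm (N q t) \<le> BN"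
    using N_bounded[of K] by blast
  obtain BC where BC: "\<And>q t. q \<in> cont_ball T K \<Longrightarrow> t \<in> {0..T} \<Longrightarrow> norm (C *v q t) \<le> BC"
    using mult_C_bounded[of K] by blast
  obtain m where m: "0 \<le> m" "\<And>x. norm (Mi *v x) \<le> norm x * m"
    using bounded_linear.nonneg_bounded[OF blin[of Mi]] by blast
  define L where "L = (BC + BC + 4 * T * BN) * m"
  have bd: "norm (- (Mi *v (C *v q t - C *v period_mean T q + zm_antideriv T (N q) t))) \<le> L"
    if q: "q \<in> cont_ball T K" and t: "t \<in> {0..T}" for q t
  proof -
    note qc = cont_ballD(1)[OF q]
    have "norm (C *v period_mean T q) \<le> BC"
      unfolding period_mean_linear[OF T blin qc, symmetric]
      by (rule norm_period_mean_le[OF T continuous_on_mult_C[OF qc] BC[OF q]])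
    then have "norm (C *v q t - C *v period_mean T q + zm_antideriv T (N q) t) \<le> BC + BC + 4 * T * BN"
      by (intro order_trans[OF norm_triangle_ineq] order_trans[OF norm_triangle_ineq4] add_mono
          norm_zm_antideriv_le[OF T] continuous_on_N qc BN[OF q] BC[OF q] t)
    then show ?thesis
      unfolding L_def norm_minus_cancel by (rule order_trans[OF m(2) mult_right_mono[OF _ m(1)]])
  qed
  have "L-lipschitz_on {0..T} (G q)" if q: "q \<in> cont_ball T K" for q
  proof (rule lipschitz_on_vector_derivative[OF G_has_vector_derivative[OF cont_ballD(1)[OF q]] bd[OF q]])
    show "0 \<le> L" using order_trans[OF norm_ge_zero bd[OF q, of 0]] T by simp
  qed
  then show ?thesis by blast
qed auto

text \<open>\<open>S\<close> is the only nonlinearity, and it is uniformly continuous on the compact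
  ball that contains all values.\<close>

lemma G_uniform_limit:
  assumes u: "\<And>n. u n \<in> cont_ball T K" and q: "q \<in> cont_ball T K"
    and lim: "uniform_limit {0..T} u q sequentially"
  shows "uniform_limit {0..T} (\<lambda>n. G (u n)) (G q) sequentially"
proof -
  note uc = cont_ballD(1)[OF u] and qc = cont_ballD(1)[OF q]
  have "uniform_limit {0..T} (\<lambda>n t. S (u n t)) (\<lambda>t. S (q t)) sequentially"
  proof (rule uniform_limit_compose_uniformly_continuous_on[OF lim, where B = "cball 0 K"])
    show "uniformly_continuous_on (cball 0 K) S"
      by (intro compact_uniformly_continuous continuous_on_subset[OF S]) auto
    show "\<forall>\<^sub>F n in sequentially. \<forall>t\<in>{0..T}. u n t \<in> cball 0 K"
      using cont_ballD(2)[OF u] by simp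
  qed simp
  then have N: "uniform_limit {0..T} (\<lambda>n. N (u n)) (N q) sequentially"
    unfolding N_def[abs_def] by (intro uniform_limit_intros)
  note NA = uniform_limit_zm_antideriv[OF T continuous_on_N[OF uc] continuous_on_N[OF qc] N]
  have "uniform_limit {0..T} (\<lambda>n. W (u n)) (W q) sequentially"
    unfolding W_def[abs_def]
    by (intro uniform_limit_add uniform_limit_zm_antideriv[OF T] continuous_on_mult_C uc qc
        bounded_linear.uniform_limit[OF blin] lim continuous_on_zm_antideriv[OF T] continuous_on_N NA)
  then show ?thesis
    unfolding G_def[abs_def]
    by (intro uniform_limit_minus bounded_linear.uniform_limit[OF bounded_linear_D]
        bounded_linear.uniform_limit[OF blin] uniform_limit_period_mean[OF T] uc qc lim N continuous_on_N)
qed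

end

section \<open>A priori bounds along the homotopy\<close>

text \<open>A solution of \<open>q = lam G q\<close> solves the boundary value problem
  \<open>M q'' + lam (C q' + S q - f - mean (S q - f)) = 0\<close>, \<open>q T = q 0\<close>, \<open>q' T = q' 0\<close>,
  while the mean part of the equation reads \<open>(1 - lam) mean q + lam D (mean (S q - f)) = 0\<close>.\<close>

locale homotopy_solution = forced_system M Mi C S f V eps T C0 sg r
  for M Mi C :: "real ^ 'n ^ 'n" and S f V eps T C0 sg r +
  fixes q and lam :: real
  assumes qc: "continuous_on {0..T} q" and lam: "0 < lam" "lam \<le> 1"
    and fp: "\<And>t. t \<in> {0..T} \<Longrightarrow> q t = lam *\<^sub>R G q t"
begin

text \<open>Bootstrapping: \<open>q = lam G q\<close> and the derivative of \<open>G q\<close>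
  express \<open>q'\<close> through \<open>q\<close> itself, so continuity of \<open>q\<close>
  already yields two derivatives.\<close>

definition dq where
  "dq t = - lam *\<^sub>R (Mi *v (C *v q t - C *v period_mean T q + zm_antideriv T (N q) t))"

definition ddq where
  "ddq t = - lam *\<^sub>R (Mi *v (C *v dq t + (N q t - period_mean T (N q))))"

lemma q_deriv: "(q has_vector_derivative dq t) (at t within {0..T})" if t: "t \<in> {0..T}"
proof (rule has_vector_derivative_transform[OF t])
  show "q s = lam *\<^sub>R G q s" if "s \<in> {0..T}" for s by (rule fp[OF that])
  show "((\<lambda>s. lam *\<^sub>R G q s) has_vector_derivative dq t) (at t within {0..T})"
    using bounded_linear.has_vector_derivative[OF bounded_linear_scaleR_right[of lam]
        G_has_vector_derivative[OF qc t]]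
    by (simp add: dq_def)
qed

lemma dq_deriv: "(dq has_vector_derivative ddq t) (at t within {0..T})" if t: "t \<in> {0..T}"
proof -
  have "((\<lambda>t. C *v q t - C *v period_mean T q + zm_antideriv T (N q) t) has_vector_derivative
      C *v dq t - 0 + (N q t - period_mean T (N q))) (at t within {0..T})"
    by (intro has_vector_derivative_add has_vector_derivative_diff has_vector_derivative_const
        bounded_linear.has_vector_derivative[OF blin] q_deriv[OF t]
        zm_antideriv_has_vector_derivative[OF T] continuous_on_N qc t)
  from bounded_linear.has_vector_derivative[OF bounded_linear_scaleR_right[of "- lam"]
      bounded_linear.has_vector_derivative[OF blin[of Mi] this]]
  show ?thesis unfolding dq_def[abs_def] ddq_def by (simp add: dq_def)
qed

lemma q_periodic: "q T = q 0"
  using fp[of 0] fp[of T] T W_periodic[OF qc] by (simp add: G_def)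

lemma dq_periodic: "dq T = dq 0"
  by (simp add: dq_def q_periodic zm_antideriv_periodic[OF T] continuous_on_N qc)

lemma ode: "M *v ddq t = - lam *\<^sub>R (C *v dq t + (N q t - period_mean T (N q)))"
  unfolding ddq_def matrix_vector_mult_scaleR matrix_vector_mul_assoc MMi matrix_vector_mul_lid
  by (rule refl)

lemma mean_equation: "(1 - lam) *\<^sub>R period_mean T q + lam *\<^sub>R D (period_mean T (N q)) = 0"
proof -
  have "period_mean T q = period_mean T (\<lambda>t. lam *\<^sub>R G q t)"
    by (rule period_mean_cong[OF T fp])
  also have "\<dots> = lam *\<^sub>R period_mean T (G q)"
    by (rule period_mean_linear[OF T bounded_linear_scaleR_right
          continuous_on_vector_derivative[OF G_has_vector_derivative[OF qc]]])
  also have "period_mean T (G q) = period_mean T q - D (period_mean T (N q)) - Mi *v period_mean T (W q)"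
    unfolding G_def[abs_def]
    by (simp add: period_mean_diff[OF T] period_mean_const[OF T] period_mean_linear[OF T blin]
        continuous_on_W qc bounded_linear.continuous_on[OF blin])
  finally show ?thesis
    unfolding period_mean_W[OF qc] by (simp add: algebra_simps)
qed

text \<open>The mean removed in the homotopy equation acts as a constant force; the last term is its
  linear potential.\<close>

definition energy where
  "energy t = (1 / 2) * (dq t \<bullet> (M *v dq t)) + lam * V (q t) - lam * (q t \<bullet> period_mean T (N q))"

lemma energy_deriv:
  assumes t: "t \<in> {0..T}"
  shows "(energy has_vector_derivative lam * (dq t \<bullet> f t - dq t \<bullet> (C *v dq t))) (at t within {0..T})"
proof -
  \<comment> \<open>Symmetry of \<open>M\<close> merges the two terms of the product rule for the
    kinetic energy, so that the equation can be inserted.\<close>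
  have sym: "x \<bullet> (M *v y) = y \<bullet> (M *v x)" for x y :: "real ^ 'n"
    by (metis M_sym dot_lmul_matrix inner_commute vector_transpose_matrix)
  have kin: "((\<lambda>t. dq t \<bullet> (M *v dq t)) has_vector_derivative
      dq t \<bullet> (M *v ddq t) + ddq t \<bullet> (M *v dq t)) (at t within {0..T})"
    by (intro bounded_bilinear.has_vector_derivative[OF bounded_bilinear_inner]
        bounded_linear.has_vector_derivative[OF blin] dq_deriv[OF t])
  have "(V has_derivative (\<lambda>h. h \<bullet> S (q t))) (at (q t) within q ` {0..T})"
    using V[of "q t"] unfolding gderiv_def by (rule has_derivative_at_withinI)
  from vector_derivative_diff_chain_within[OF q_deriv[OF t] this]
  have pot: "((\<lambda>t. V (q t)) has_vector_derivative dq t \<bullet> S (q t)) (at t within {0..T})"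
    by (simp add: o_def)
  have lin: "((\<lambda>t. q t \<bullet> period_mean T (N q)) has_vector_derivative dq t \<bullet> period_mean T (N q)) (at t within {0..T})"
    by (rule bounded_linear.has_vector_derivative[OF bounded_linear_inner_left q_deriv[OF t]])
  have "(energy has_vector_derivative
      (1 / 2) * (dq t \<bullet> (M *v ddq t) + ddq t \<bullet> (M *v dq t)) + lam * (dq t \<bullet> S (q t))
        - lam * (dq t \<bullet> period_mean T (N q))) (at t within {0..T})"
    unfolding energy_def[abs_def]
    by (intro has_vector_derivative_add has_vector_derivative_diff kin pot lin
        bounded_linear.has_vector_derivative[OF bounded_linear_mult_right])
  moreover have "(1 / 2) * (dq t \<bullet> (M *v ddq t) + ddq t \<bullet> (M *v dq t)) + lam * (dq t \<bullet> S (q t))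
        - lam * (dq t \<bullet> period_mean T (N q)) = lam * (dq t \<bullet> f t - dq t \<bullet> (C *v dq t))"
    unfolding sym[of "ddq t" "dq t"] ode N_def
    by (simp add: inner_add_right inner_diff_right algebra_simps)
  ultimately show ?thesis by simp
qed

text \<open>Instead of bounding \<open>\<integral> \<bar>q'\<bar>\<^sup>2\<close>, the proof dominates \<open>\<bar>q'\<bar>\<close> pointwise by the derivative
  of \<open>L t = c t - sg energy t / (lam C0)\<close>, whose energy part cancels over a period.\<close>

lemma oscillation:
  assumes F: "0 \<le> F" "\<And>t. t \<in> {0..T} \<Longrightarrow> norm (f t) \<le> F"
    and s: "s \<in> {0..T}" and t: "t \<in> {0..T}"
  shows "norm (q t - q s) \<le> (1 / 2 + (F / C0)\<^sup>2 / 2) * T"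
proof -
  \<comment> \<open>With \<open>x = \<bar>q'\<bar>\<close> and \<open>y = F / C0\<close>, damping
    gives \<open>L' \<ge> c - x * y + x\<^sup>2\<close>; the choice
    \<open>c = (1 + y\<^sup>2) / 2\<close> makes this at least \<open>x\<close> by completing two
    squares.\<close>
  define c where "c = 1 / 2 + (F / C0)\<^sup>2 / 2"
  \<comment> \<open>Dividing by \<open>lam\<close> cancels the factor \<open>lam\<close> in the
    derivative of the energy, so the bound is independent of \<open>lam\<close>; \<open>sg\<close>
    turns the damping term positive.\<close>
  define L where "L t = c * t - (sg / (lam * C0)) * energy t" for t
  define L' where "L' t = c - (sg / (lam * C0)) * (lam * (dq t \<bullet> f t - dq t \<bullet> (C *v dq t)))" for t
  have L: "(L has_vector_derivative L' t) (at t within {0..T})" if t: "t \<in> {0..T}" for t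
  proof -
    have "((\<lambda>t. c * t) has_vector_derivative c * 1) (at t within {0..T})"
      by (rule bounded_linear.has_vector_derivative[OF bounded_linear_mult_right])
        (simp add: has_vector_derivative_id[unfolded id_def])
    then show ?thesis
      unfolding L_def[abs_def] L'_def
      using has_vector_derivative_diff[OF _ bounded_linear.has_vector_derivative[OF
            bounded_linear_mult_right energy_deriv[OF t]]]
      by fastforce
  qed
  have le: "norm (dq t) \<le> L' t" if t: "t \<in> {0..T}" for t
  proof -
    define x where "x = norm (dq t)"
    define y where "y = F / C0"
    have "sg * (dq t \<bullet> f t) \<le> \<bar>dq t \<bullet> f t\<bar>"
      using sg by (metis abs_ge_self abs_mult mult_1)
    also have "\<dots> \<le> x * norm (f t)" unfolding x_def by (rule Cauchy_Schwarz_ineq2)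
    also have "\<dots> \<le> x * F" by (rule mult_left_mono[OF F(2)[OF t]]) (simp add: x_def)
    finally have "sg * (dq t \<bullet> f t) \<le> x * F" .
    then have "(sg * (dq t \<bullet> f t) - sg * (dq t \<bullet> (C *v dq t))) / C0 \<le> (x * F - C0 * x\<^sup>2) / C0"
      using damping[of "dq t"] C0 unfolding x_def by (intro divide_right_mono) auto
    also have "\<dots> = x * y - x\<^sup>2" using C0 by (simp add: y_def field_simps)
    finally have "(sg * (dq t \<bullet> f t) - sg * (dq t \<bullet> (C *v dq t))) / C0 \<le> x * y - x\<^sup>2" .
    moreover have "L' t = 1 / 2 + y\<^sup>2 / 2 - (sg * (dq t \<bullet> f t) - sg * (dq t \<bullet> (C *v dq t))) / C0"
      unfolding L'_def c_def y_def using lam C0 by (simp add: right_diff_distrib diff_divide_distrib)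
    moreover have "0 \<le> (x - y)\<^sup>2 + (x - 1)\<^sup>2" by simp
    then have "x \<le> 1 / 2 + y\<^sup>2 / 2 - (x * y - x\<^sup>2)" by (simp add: power2_eq_square algebra_simps)
    ultimately show ?thesis unfolding x_def by linarith
  qed
  have cont: "continuous_on {0..T} L" by (rule continuous_on_vector_derivative[OF L])
  have step: "norm (q b - q a) \<le> L b - L a" if ab: "0 \<le> a" "a < b" "b \<le> T" for a b
  proof (rule differentiable_bound_general[OF ab(2)])
    show "continuous_on {a..b} q" "continuous_on {a..b} L"
      by (rule continuous_on_subset[OF qc], use ab in force, rule continuous_on_subset[OF cont], use ab in force)
    fix x assume x: "a < x" "x < b"
    then have xT: "x \<in> {0..T}" and at: "at x within {0..T} = at x"
      using ab by (auto intro: at_within_Icc_at)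
    show "(q has_vector_derivative dq x) (at x)" "(L has_vector_derivative L' x) (at x)"
      using q_deriv[OF xT] L[OF xT] unfolding at by auto
    show "norm (dq x) \<le> L' x" by (rule le[OF xT])
  qed
  have mono: "L a \<le> L b" if "0 \<le> a" "a \<le> b" "b \<le> T" for a b
    using step[of a b] that order_trans[OF norm_ge_zero] by (cases "a = b") fastforce+
  have "energy T = energy 0" by (simp add: energy_def q_periodic dq_periodic)
  then have LT: "L T - L 0 = c * T" by (simp add: L_def)
  \<comment> \<open>\<open>L\<close> is nondecreasing, so its increment over a subinterval is at
    most its increment over the whole period.\<close>
  have "norm (q b - q a) \<le> c * T" if "0 \<le> a" "a < b" "b \<le> T" for a b
    using step[OF that] mono[of 0 a] mono[of b T] that LT by force
  from this[of s t] this[of t s] show ?thesis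
    using s t T unfolding c_def[symmetric]
    by (cases s t rule: linorder_cases) (auto simp: norm_minus_commute c_def)
qed

text \<open>\<open>g\<close> is the mean equation before averaging, with \<open>f t\<close> replaced
  by its mean, which leaves the average unchanged. At a zero of its component \<open>j\<close>,
  multiplication by component \<open>j\<close> of \<open>q\<close> would give a nonnegative and,
  beyond \<open>r\<close>, a strictly positive term with sum 0. The sign condition holds whatever
  the other components are, so one component can be treated at a time.\<close>

lemma component_small: "\<exists>t\<in>{0..T}. \<bar>q t $ j\<bar> \<le> r"
proof -
  define g where "g t = (1 - lam) *\<^sub>R q t + lam *\<^sub>R D (S (q t) - period_mean T f)" for t
  have Sq: "continuous_on {0..T} (\<lambda>t. S (q t))"
    by (rule continuous_on_compose2[OF S qc]) simp
  have D: "continuous_on {0..T} (\<lambda>t. D (S (q t) - period_mean T f))"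
    by (intro bounded_linear.continuous_on[OF bounded_linear_D] continuous_intros Sq)
  have g: "continuous_on {0..T} g"
    unfolding g_def[abs_def] by (intro continuous_intros qc D)
  have "period_mean T (N q) = period_mean T (\<lambda>t. S (q t) - period_mean T f)"
    unfolding N_def[abs_def] by (simp add: period_mean_diff[OF T] period_mean_const[OF T] Sq f)
  then have "D (period_mean T (N q)) = period_mean T (\<lambda>t. D (S (q t) - period_mean T f))"
    by (simp add: period_mean_linear[OF T bounded_linear_D] continuous_on_diff Sq)
  then have "period_mean T g = 0"
    using mean_equation unfolding g_def[abs_def]
    by (simp add: period_mean_add[OF T] continuous_on_scaleR qc D
        period_mean_linear[OF T bounded_linear_scaleR_right])
  with period_mean_mvt[OF T g, of j] obtain t where t: "t \<in> {0..T}" and "g t $ j = 0"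
    by (metis zero_index)
  then have z: "(1 - lam) * q t $ j + lam * (eps j * (S (q t) $ j - period_mean T f $ j)) = 0"
    by (simp add: g_def D_def)
  have "\<not> r < \<bar>q t $ j\<bar>"
  proof
    assume "r < \<bar>q t $ j\<bar>"
    from restoring[OF this] lam
    have "0 < lam * (eps j * (q t $ j * (S (q t) $ j - period_mean T f $ j)))" by simp
    moreover have "0 \<le> (1 - lam) * (q t $ j)\<^sup>2" using lam by simp
    moreover have "(1 - lam) * (q t $ j)\<^sup>2 + lam * (eps j * (q t $ j * (S (q t) $ j - period_mean T f $ j)))
       = q t $ j * ((1 - lam) * q t $ j + lam * (eps j * (S (q t) $ j - period_mean T f $ j)))"
      by (simp add: power2_eq_square algebra_simps)
    ultimately show False using z by simp
  qed
  then have "\<bar>q t $ j\<bar> \<le> r" by simp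
  then show ?thesis using t by blast
qed

lemma apriori_bound:
  assumes F: "0 \<le> F" "\<And>t. t \<in> {0..T} \<Longrightarrow> norm (f t) \<le> F" and t: "t \<in> {0..T}"
  shows "norm (q t) \<le> real CARD('n) * (r + (1 / 2 + (F / C0)\<^sup>2 / 2) * T)"
proof -
  have "\<bar>q t $ j\<bar> \<le> r + (1 / 2 + (F / C0)\<^sup>2 / 2) * T" for j
  proof -
    \<comment> \<open>The time \<open>s\<close> varies with \<open>j\<close>; this is harmless
      because the oscillation bound is uniform over all pairs of times.\<close>
    obtain s where s: "s \<in> {0..T}" "\<bar>q s $ j\<bar> \<le> r" using component_small by blast
    have "\<bar>(q t - q s) $ j\<bar> \<le> norm (q t - q s)" by (rule component_le_norm_cart)
    also have "\<dots> \<le> (1 / 2 + (F / C0)\<^sup>2 / 2) * T" by (rule oscillation[OF F s(1) t])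
    finally show ?thesis using s(2) by simp
  qed
  then have "(\<Sum>j\<in>UNIV. \<bar>q t $ j\<bar>) \<le> real CARD('n) * (r + (1 / 2 + (F / C0)\<^sup>2 / 2) * T)"
    using sum_bounded_above[of UNIV "\<lambda>j. \<bar>q t $ j\<bar>" "r + (1 / 2 + (F / C0)\<^sup>2 / 2) * T"] by simp
  then show ?thesis using norm_le_l1_cart[of "q t"] by linarith
qed

end

section \<open>Existence on one period\<close>

context forced_system
begin

lemma solution_on_period:
  "\<exists>q q' q''.
    (\<forall>t\<in>{0..T}. (q has_vector_derivative q' t) (at t within {0..T})) \<and>
    (\<forall>t\<in>{0..T}. (q' has_vector_derivative q'' t) (at t within {0..T})) \<and>
    (\<forall>t\<in>{0..T}. M *v q'' t + C *v q' t + S (q t) = f t) \<and>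
    continuous_on {0..T} q'' \<and> q T = q 0 \<and> q' T = q' 0 \<and> q'' T = q'' 0"
proof -
  obtain F where F: "0 \<le> F" "\<And>t. t \<in> {0..T} \<Longrightarrow> norm (f t) \<le> F" using f_bounded by blast
  define K where "K = real CARD('n) * (r + (1 / 2 + (F / C0)\<^sup>2 / 2) * T)"
  have "0 \<le> K" using T r by (simp add: K_def)
  have "\<exists>q. continuous_on {0..T} q \<and> (\<forall>t\<in>{0..T}. G q t = q t)"
  \<comment> \<open>\<open>K + 1\<close> makes the a priori bound strict and the radius
    positive.\<close>
  proof (rule leray_schauder_lipschitz[OF T, where R = "K + 1"])
    fix q lam t assume "continuous_on {0..T} q" "0 < lam" "lam \<le> 1"
      "\<And>t. t \<in> {0..T} \<Longrightarrow> q t = lam *\<^sub>R G q t" and t: "t \<in> {0..T}"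
    then interpret homotopy_solution M Mi C S f V eps T C0 sg r q lam
      by unfold_locales
    show "norm (q t) < K + 1" using apriori_bound[OF F t] by (simp add: K_def)
  next
    show "uniform_limit {0..T} (\<lambda>n. G (u n)) (G q) sequentially"
      if "\<And>n. u n \<in> cont_ball T K'" "q \<in> cont_ball T K'" "uniform_limit {0..T} u q sequentially" for K' u q
      by (rule G_uniform_limit[OF that])
  qed (use \<open>0 \<le> K\<close> G_bounded G_lipschitz in auto)
  then obtain q where q: "continuous_on {0..T} q" "\<And>t. t \<in> {0..T} \<Longrightarrow> q t = 1 *\<^sub>R G q t"
    by auto
  \<comment> \<open>At \<open>lam = 1\<close> the mean equation reads
    \<open>D (mean (N q)) = 0\<close>. As no \<open>eps j\<close> vanishes, the mean drops out of
    the equation and the original system remains.\<close>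
  interpret homotopy_solution M Mi C S f V eps T C0 sg r q 1
    by unfold_locales (use q in auto)
  have "D (period_mean T (N q)) = 0" using mean_equation by simp
  then have mean0: "period_mean T (N q) = 0"
    using eps by (simp add: D_def vec_eq_iff)
  show ?thesis
  proof (intro exI conjI ballI)
    show "M *v ddq t + C *v dq t + S (q t) = f t" for t
      unfolding ode mean0 by (simp add: N_def)
    show "continuous_on {0..T} ddq"
      unfolding ddq_def[abs_def]
      by (intro continuous_intros bounded_linear.continuous_on[OF blin] continuous_on_N qc
          continuous_on_vector_derivative[OF dq_deriv])
    show "ddq T = ddq 0" by (simp add: ddq_def dq_periodic N_def q_periodic f_per)
  qed (simp_all add: q_deriv dq_deriv q_periodic dq_periodic)
qed

end

subsection \<open>Periodic extension and the existence theorem\<close>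

definition periodic_ext :: "real \<Rightarrow> (real \<Rightarrow> 'a) \<Rightarrow> real \<Rightarrow> 'a" where
  "periodic_ext T u t = u (t - of_int \<lfloor>t / T\<rfloor> * T)"

lemma periodic_ext_arg_mem: "0 < T \<Longrightarrow> t - of_int \<lfloor>t / T\<rfloor> * T \<in> {0..T}"
  using floor_divide_lower[of T t] floor_divide_upper[of T t] by (auto simp: algebra_simps)

lemma periodic_fun_simple_periodic_ext:
  assumes "0 < T" shows "periodic_fun_simple (periodic_ext T u) T"
proof
  fix x
  have "(x + T) / T = x / T + 1" using assms by (simp add: field_simps)
  then have "x + T - of_int \<lfloor>(x + T) / T\<rfloor> * T = x - of_int \<lfloor>x / T\<rfloor> * T"
    by (simp add: algebra_simps)
  then show "periodic_ext T u (x + T) = periodic_ext T u x"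
    unfolding periodic_ext_def by (rule arg_cong)
qed

text \<open>The floor sends the right endpoint of a closed period to 0 and not to \<open>T\<close>;
  there the formula rests on \<open>u T = u 0\<close>.\<close>

lemma periodic_ext_eq:
  assumes T: "0 < T" and u: "u T = u 0" and t: "t \<in> {of_int k * T .. (of_int k + 1) * T}"
  shows "periodic_ext T u t = u (t - of_int k * T)"
proof (cases "t = (of_int k + 1) * T")
  case True
  then have "t / T = of_int (k + 1)" using T by simp
  then have "\<lfloor>t / T\<rfloor> = k + 1" by (metis floor_of_int)
  then show ?thesis using True u by (simp add: periodic_ext_def algebra_simps)
next
  case False
  with t have "of_int k * T \<le> t" "t < (of_int k + 1) * T" by auto
  then have "\<lfloor>t / T\<rfloor> = k" using T by (intro floor_unique) (auto simp: field_simps)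
  then show ?thesis by (simp add: periodic_ext_def)
qed

text \<open>Continuity and differentiability are both limits at a point, so this glues either of
  them across periods. At a multiple of \<open>T\<close> the limits from the two adjacent periods
  combine to a two-sided one.\<close>

lemma tendsto_at_from_periods:
  fixes t T :: real
  assumes T: "0 < T"
    and lim: "\<And>k :: int. t \<in> {of_int k * T .. (of_int k + 1) * T} \<Longrightarrow>
      (h \<longlongrightarrow> l) (at t within {of_int k * T .. (of_int k + 1) * T})"
  shows "(h \<longlongrightarrow> l) (at t)"
proof -
  define k where "k = \<lfloor>t / T\<rfloor>"
  have k: "of_int k * T \<le> t" "t < (of_int k + 1) * T"
    using floor_divide_lower[OF T, of t] floor_divide_upper[OF T, of t] by (auto simp: k_def)
  show ?thesis
  proof (cases "t = of_int k * T")
    case False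
    then have "at t within {of_int k * T .. (of_int k + 1) * T} = at t"
      using k by (intro at_within_Icc_at) auto
    with lim[of k] k show ?thesis by simp
  next
    case True
    have "(h \<longlongrightarrow> l) (at t within ({of_int (k - 1) * T .. (of_int (k - 1) + 1) * T} \<union> {of_int k * T .. (of_int k + 1) * T}))"
      by (intro Lim_Un lim) (use True T k in \<open>auto simp: algebra_simps\<close>)
    also have "{of_int (k - 1) * T .. (of_int (k - 1) + 1) * T} \<union> {of_int k * T .. (of_int k + 1) * T}
        = {of_int (k - 1) * T .. (of_int k + 1) * T}"
      using T by (intro subst[OF ivl_disj_un_two_touch(4)]) (auto simp: algebra_simps)
    also have "at t within {of_int (k - 1) * T .. (of_int k + 1) * T} = at t"
      using True T k by (intro at_within_Icc_at) (auto simp: algebra_simps)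
    finally show ?thesis .
  qed
qed

lemma continuous_on_periodic_ext:
  fixes u :: "real \<Rightarrow> 'a::topological_space"
  assumes T: "0 < T" and u: "u T = u 0" and cont: "continuous_on {0..T} u"
  shows "continuous_on UNIV (periodic_ext T u)"
  unfolding continuous_on_eq_continuous_within
proof
  fix t :: real
  show "isCont (periodic_ext T u) t"
    unfolding isCont_def
  proof (rule tendsto_at_from_periods[OF T])
    fix k :: int
    let ?I = "{of_int k * T .. (of_int k + 1) * T}"
    assume t: "t \<in> ?I"
    have "continuous_on ?I (\<lambda>s. u (s - of_int k * T))"
      by (intro continuous_on_compose2[OF cont] continuous_intros) (auto simp: algebra_simps)
    then have "continuous_on ?I (periodic_ext T u)"
      by (rule continuous_on_cong[THEN iffD1, rotated 2]) (auto simp: periodic_ext_eq[OF T u])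
    then show "(periodic_ext T u \<longlongrightarrow> periodic_ext T u t) (at t within ?I)"
      using t by (simp add: continuous_on_def)
  qed
qed

text \<open>Unfolding the derivative to the limit of a difference quotient makes the gluing lemma
  applicable; on each period the extension is a translate of \<open>u\<close>.\<close>

lemma has_vector_derivative_periodic_ext:
  fixes u :: "real \<Rightarrow> 'a::real_normed_vector"
  assumes T: "0 < T" and u: "u T = u 0" and u': "u' T = u' 0"
    and der: "\<And>t. t \<in> {0..T} \<Longrightarrow> (u has_vector_derivative u' t) (at t within {0..T})"
  shows "(periodic_ext T u has_vector_derivative periodic_ext T u' t) (at t)"
  unfolding has_vector_derivative_def has_derivative_within
proof (intro conjI tendsto_at_from_periods[OF T])
  fix k :: int
  let ?I = "{of_int k * T .. (of_int k + 1) * T}"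
  assume t: "t \<in> ?I"
  have im: "(\<lambda>s. s - of_int k * T) ` ?I = {0..T}"
    by (auto simp: image_iff algebra_simps intro!: bexI[of _ "_ + of_int k * T"])
  have "((\<lambda>s. s - of_int k * T) has_vector_derivative 1) (at t within ?I)"
    by (auto intro!: derivative_eq_intros)
  from vector_diff_chain_within[OF this, of u, unfolded im, OF der]
  have *: "((\<lambda>s. u (s - of_int k * T)) has_vector_derivative u' (t - of_int k * T)) (at t within ?I)"
    using t by (auto simp: o_def algebra_simps)
  have "(periodic_ext T u has_vector_derivative periodic_ext T u' t) (at t within ?I)"
    unfolding periodic_ext_eq[OF T u', OF t]
    by (rule has_vector_derivative_transform[OF t _ *]) (rule periodic_ext_eq[OF T u])
  then show "((\<lambda>y. (1 / norm (y - t)) *\<^sub>R (periodic_ext T u y -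
      (periodic_ext T u t + (y - t) *\<^sub>R periodic_ext T u' t))) \<longlongrightarrow> 0) (at t within ?I)"
    unfolding has_vector_derivative_def has_derivative_within by blast
qed (rule bounded_linear_scaleR_left)

section \<open>Sign of the damping form and assembly of the theorem\<close>

text \<open>If the form took both signs, it would vanish on the segment between two such points. By
  the strict bound that zero is the origin, so the points are collinear, yet a quadratic form keeps
  its sign along a line through the origin. This covers dimension one as well, where the punctured
  space is disconnected.\<close>

lemma definite_form_sign:
  fixes C :: "real ^ 'n ^ 'n"
  assumes C0: "0 < C0" and C: "\<And>x. x \<noteq> 0 \<Longrightarrow> C0 * (norm x)\<^sup>2 < \<bar>x \<bullet> (C *v x)\<bar>"
  obtains sg :: real where "\<bar>sg\<bar> = 1" "\<And>x. C0 * (norm x)\<^sup>2 \<le> sg * (x \<bullet> (C *v x))"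
proof -
  define Q where "Q x = x \<bullet> (C *v x)" for x :: "real ^ 'n"
  have Q0: "Q 0 = 0" by (simp add: Q_def)
  have Q: "C0 * (norm x)\<^sup>2 < \<bar>Q x\<bar>" if "x \<noteq> 0" for x using C[OF that] by (simp add: Q_def)
  have Qpos: "0 < \<bar>Q x\<bar>" if "x \<noteq> 0" for x
    using Q[OF that] C0 by (intro order_le_less_trans[OF _ Q[OF that]]) simp
  have Qs: "Q (c *\<^sub>R x) = c\<^sup>2 * Q x" for c x
    by (simp add: Q_def matrix_vector_mult_scaleR power2_eq_square)
  have no: False if x: "0 < Q x" and y: "Q y < 0" for x y
  proof -
    have "continuous_on {0..1} (\<lambda>s. Q ((1 - s) *\<^sub>R x + s *\<^sub>R y))"
      unfolding Q_def
      by (intro continuous_intros bounded_linear.continuous_on[OF matrix_vector_mul_bounded_linear])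
    from IVT2'[OF _ _ _ this, of 0] x y obtain s where s: "0 \<le> s" "s \<le> 1" "Q ((1 - s) *\<^sub>R x + s *\<^sub>R y) = 0"
      by force
    then have "(1 - s) *\<^sub>R x + s *\<^sub>R y = 0" using Qpos by force
    then have "(1 - s) *\<^sub>R x = (- s) *\<^sub>R y" by (simp add: eq_neg_iff_add_eq_0)
    then have *: "(1 - s)\<^sup>2 * Q x = s\<^sup>2 * Q y" using Qs by (metis power2_minus)
    have "0 \<le> (1 - s)\<^sup>2 * Q x" "s\<^sup>2 * Q y \<le> 0" using x y by (auto simp: mult_nonneg_nonpos)
    with * have "(1 - s)\<^sup>2 * Q x = 0" "s\<^sup>2 * Q y = 0" by linarith+
    with x y show False by auto
  qed
  show ?thesis
  proof (cases "\<exists>y. Q y < 0")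
    case True
    then obtain y where "Q y < 0" ..
    then have le0: "Q x \<le> 0" for x using no[of x y] not_le by blast
    have "C0 * (norm x)\<^sup>2 \<le> - 1 * Q x" for x
      using Q[of x] Q0 le0[of x] by (cases "x = 0") (auto simp: abs_if split: if_splits)
    then show ?thesis using that[of "-1"] by (simp add: Q_def)
  next
    case False
    then have ge0: "0 \<le> Q x" for x by (simp add: not_less)
    have "C0 * (norm x)\<^sup>2 \<le> 1 * Q x" for x
      using Q[of x] Q0 ge0[of x] by (cases "x = 0") auto
    then show ?thesis using that[of 1] by (simp add: Q_def)
  qed
qed

lemma sym_pos_def_right_inverse:
  assumes "sym_pos_def M" shows "\<exists>Mi. M ** Mi = mat 1"
proof -
  have "\<forall>x. M *v x = 0 \<longrightarrow> x = 0"
    using assms unfolding sym_pos_def_def by (metis inner_zero_right less_irrefl)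
  then show ?thesis
    using matrix_left_invertible_ker[of M] matrix_left_right_inverse by blast
qed

theorem theorem3p1:
  fixes M C :: "real ^ 'n ^ 'n"
    and S :: "real ^ 'n \<Rightarrow> real ^ 'n"
    and f :: "real \<Rightarrow> real ^ 'n"
    and T :: real
    and coord :: "nat \<Rightarrow> 'n"
  assumes "bij_betw coord {1..CARD('n)} UNIV"
    and "T > 0"
    and "sym_pos_def M"
    and "continuous_on UNIV S"
    and "continuous_on UNIV f"
    and "periodic_fun_simple f T"
    and "\<exists>C0>0. \<forall>x. x \<noteq> 0 \<longrightarrow> \<bar>x \<bullet> (C *v x)\<bar> > C0 * (norm x)\<^sup>2"
    and "\<exists>V. C1_potential V S"
    and "\<exists>r>0. \<exists>n\<le>CARD('n). \<forall>q.
           (\<forall>j\<in>{1..n}. \<bar>q $ coord j\<bar> > r \<longrightarrow>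
              q $ coord j * (S q $ coord j - period_mean T f $ coord j) > 0) \<and>
           (\<forall>j\<in>{n+1..CARD('n)}. \<bar>q $ coord j\<bar> > r \<longrightarrow>
              q $ coord j * (S q $ coord j - period_mean T f $ coord j) < 0)"
  shows "\<exists>q :: real \<Rightarrow> real ^ 'n. C2_solution M C S f q \<and> periodic_fun_simple q T"
proof -
  note T = \<open>T > 0\<close>
  interpret f: periodic_fun_simple f T by fact
  obtain Mi where Mi: "M ** Mi = mat 1"
    using sym_pos_def_right_inverse[OF \<open>sym_pos_def M\<close>] by blast
  obtain V where V: "\<And>q. GDERIV V q :> S q"
    using \<open>\<exists>V. C1_potential V S\<close> unfolding C1_potential_def by blast
  obtain C0 where C0: "0 < C0" "\<And>x. x \<noteq> 0 \<Longrightarrow> C0 * (norm x)\<^sup>2 < \<bar>x \<bullet> (C *v x)\<bar>"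
    using assms(7) by blast
  obtain sg :: real where sg: "\<bar>sg\<bar> = 1" "\<And>x. C0 * (norm x)\<^sup>2 \<le> sg * (x \<bullet> (C *v x))"
    using definite_form_sign[OF C0] by blast
  obtain r n where r: "r > 0" and
    pos: "\<And>q j. j \<in> {1..n} \<Longrightarrow> \<bar>q $ coord j\<bar> > r \<Longrightarrow>
              q $ coord j * (S q $ coord j - period_mean T f $ coord j) > 0" and
    neg: "\<And>q j. j \<in> {n+1..CARD('n)} \<Longrightarrow> \<bar>q $ coord j\<bar> > r \<Longrightarrow>
              q $ coord j * (S q $ coord j - period_mean T f $ coord j) < 0"
    using assms(9) by blast
  \<comment> \<open>An index outside the image of \<open>{1..n}\<close> still has a number, as
    \<open>coord\<close> is onto, and that number exceeds \<open>n\<close>; there the condition is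
    repelling and the sign is reversed.\<close>
  define eps where "eps i = (if i \<in> coord ` {1..n} then 1 else - 1 :: real)" for i
  have restoring: "0 < eps i * (q $ i * (S q $ i - period_mean T f $ i))" if "r < \<bar>q $ i\<bar>" for q i
  proof (cases "i \<in> coord ` {1..n}")
    case True
    then show ?thesis using pos that by (auto simp: eps_def)
  next
    case False
    obtain j where j: "j \<in> {1..CARD('n)}" "i = coord j"
      using assms(1) by (metis UNIV_I bij_betw_imp_surj_on imageE)
    with False have "j \<in> {n+1..CARD('n)}" by force
    from neg[OF this, of q] show ?thesis using that j(2) False by (simp add: eps_def)
  qed
  interpret forced_system M Mi C S f V eps T C0 sg r
  proof
    show "transpose M = M" using \<open>sym_pos_def M\<close> by (simp add: sym_pos_def_def)
    show "continuous_on {0..T} f" using \<open>continuous_on UNIV f\<close> by (rule continuous_on_subset) simp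
    show "f T = f 0" using f.plus_period[of 0] by simp
    show "eps j \<noteq> 0" for j by (simp add: eps_def)
  qed (fact T Mi assms(4) C0(1) sg V r restoring)+
  obtain q q' q'' where q:
    "\<And>t. t \<in> {0..T} \<Longrightarrow> (q has_vector_derivative q' t) (at t within {0..T})"
    "\<And>t. t \<in> {0..T} \<Longrightarrow> (q' has_vector_derivative q'' t) (at t within {0..T})"
    "\<And>t. t \<in> {0..T} \<Longrightarrow> M *v q'' t + C *v q' t + S (q t) = f t"
    "continuous_on {0..T} q''" "q T = q 0" "q' T = q' 0" "q'' T = q'' 0"
    using solution_on_period by blast
  \<comment> \<open>The three extensions are evaluated at the same reduced time, and
    \<open>f\<close> at that time equals \<open>f t\<close> by periodicity.\<close>
  have eq: "M *v periodic_ext T q'' t + C *v periodic_ext T q' t + S (periodic_ext T q t) = f t" for t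
    using q(3)[OF periodic_ext_arg_mem[OF T, of t]] f.minus_of_int[of t "\<lfloor>t / T\<rfloor>"]
    by (simp add: periodic_ext_def)
  have "C2_solution M C S f (periodic_ext T q)"
    unfolding C2_solution_def
    by (intro exI[of _ "periodic_ext T q'"] exI[of _ "periodic_ext T q''"] conjI allI eq
        has_vector_derivative_periodic_ext T q continuous_on_periodic_ext)
  then show ?thesis
    using periodic_fun_simple_periodic_ext[OF T] by blast
qed

end
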